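(* Assume that $p$, $N$, $d$, $c$ satisfy Condition A or Condition B. Let $g_c(x)=x^d+cx^{d+1}$ and let $\phi_c(x)=x\left(1+\sum_{n\ge1}b_nx^n\right)\in\mathbb{C}_p[[x]]$ be the Böttcher coordinate, i.e. the unique such series with $\phi_c(g_c(x))=\phi_c(x)^d$ (equivalently $\left(1+\sum_{n\ge1}b_nx^n\right)^d=1+cx+\sum_{n\ge1}b_nx^{nd}(1+cx)^{n+1}$). Let $\phi_c^{-1}$ be its compositional inverse. Then the maximal convergent open disks of $\phi_c(x)$ and $\phi_c^{-1}(x)$ are both $D(0,r_N^{-1})=\{x\in\mathbb{C}_p:|x|_p<r_N^{-1}\}$, where $r_N=\left(|c/d^{N+1}|_p\,p^{1/(p-1)}\right)^{1/d^N}>1$. Moreover, $\phi_c$ is a bijective isometry from $D(0,r_N^{-1})$ onto itself.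
   Context: Let $p$ be a prime, $\mathbb{C}_p$ the completion of an algebraic closure of $\mathbb{Q}_p$, $v_p$ the valuation with $v_p(p)=1$, $|x|_p=p^{-v_p(x)}$. Let $d\ge2$ be an integer and $c\in\mathbb{C}_p$. Condition A: $N=0$, $d$ is a multiple of $p$, and $v_p(c)<v_p(d)+\frac{v_p((d-1)!)}{d-1}$. Condition B: $N\ge1$ is an integer, $d$ is a power of $p$, and $Nv_p(d)+\frac{v_p((d-1)!)}{d-1}<v_p(c)<(N+1)v_p(d)+\frac{v_p((d-1)!)}{d-1}$. The maximal convergent open disk of a power series in $x$ is the open disk $D(0,R)$ where $R$ is its radius of convergence. *)

theory Defs
  imports "HOL-Analysis.Analysis" "HOL-Computational_Algebra.Computational_Algebra"
begin

text \<open>Abstract characterisation of C_p: a field of characteristic 0 with an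
absolute value nv that is non-archimedean, satisfies |p| = 1/p (so it restricts to
the p-adic absolute value on Q), is algebraically closed, complete, and in which
the algebraic numbers are dense.  Any such field is isometrically isomorphic to C_p.\<close>

definition is_Cp_absval :: "nat \<Rightarrow> ('a::field_char_0 \<Rightarrow> real) \<Rightarrow> bool" where
  "is_Cp_absval p nv \<longleftrightarrow>
     prime p \<and>
     nv 0 = 0 \<and> (\<forall>x. x \<noteq> 0 \<longrightarrow> nv x > 0) \<and>
     (\<forall>x y. nv (x * y) = nv x * nv y) \<and>
     (\<forall>x y. nv (x + y) \<le> max (nv x) (nv y)) \<and>
     nv (of_nat p) = 1 / real p \<and>
     (\<forall>q :: 'a poly. degree q > 0 \<longrightarrow> (\<exists>x. poly q x = 0)) \<and>
     (\<forall>s :: nat \<Rightarrow> 'a. (\<forall>e>0. \<exists>M. \<forall>m\<ge>M. \<forall>n\<ge>M. nv (s m - s n) < e)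
          \<longrightarrow> (\<exists>l. (\<lambda>n. nv (s n - l)) \<longlonglongrightarrow> 0)) \<and>
     (\<forall>x. \<forall>e>0. \<exists>y. algebraic y \<and> nv (x - y) < e)"

definition vp :: "nat \<Rightarrow> ('a \<Rightarrow> real) \<Rightarrow> 'a \<Rightarrow> real" where
  "vp p nv x = - log (real p) (nv x)"

text \<open>Radius of convergence of sum a_n x^n w.r.t. nv: sup of r \<ge> 0 with |a_n| r^n \<rightarrow> 0
(in a complete non-archimedean field this is exactly where the series converges).\<close>
definition nv_conv_radius :: "('a \<Rightarrow> real) \<Rightarrow> (nat \<Rightarrow> 'a) \<Rightarrow> ereal" where
  "nv_conv_radius nv a = (SUP r \<in> {r::real. 0 \<le> r \<and> (\<lambda>n. nv (a n) * r ^ n) \<longlonglongrightarrow> 0}. ereal r)"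

definition nv_eval :: "('a::comm_ring_1 \<Rightarrow> real) \<Rightarrow> 'a fps \<Rightarrow> 'a \<Rightarrow> 'a" where
  "nv_eval nv f x = (THE s. (\<lambda>n. nv ((\<Sum>i<n. fps_nth f i * x ^ i) - s)) \<longlonglongrightarrow> 0)"

definition condA :: "nat \<Rightarrow> ('a::field_char_0 \<Rightarrow> real) \<Rightarrow> nat \<Rightarrow> nat \<Rightarrow> 'a \<Rightarrow> bool" where
  "condA p nv N d c \<longleftrightarrow> N = 0 \<and> p dvd d \<and> c \<noteq> 0 \<and>
     vp p nv c < real (multiplicity p d) + real (multiplicity p (fact (d - 1) :: nat)) / (real d - 1)"

definition condB :: "nat \<Rightarrow> ('a::field_char_0 \<Rightarrow> real) \<Rightarrow> nat \<Rightarrow> nat \<Rightarrow> 'a \<Rightarrow> bool" where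
  "condB p nv N d c \<longleftrightarrow> N \<ge> 1 \<and> (\<exists>k. d = p ^ k) \<and> c \<noteq> 0 \<and>
     real N * real (multiplicity p d) + real (multiplicity p (fact (d - 1) :: nat)) / (real d - 1)
       < vp p nv c \<and>
     vp p nv c < real (N + 1) * real (multiplicity p d)
                 + real (multiplicity p (fact (d - 1) :: nat)) / (real d - 1)"

end

theory Submission
  imports Defs
begin

text \<open>
  Write \<open>\<phi> = x B(x)\<close>. The functional equation becomes \<open>B\<^sup>d = (1 + c x) (B \<circ> g)\<close>, and iterating it gives
  \<open>B\<close> as the product over \<open>k \<ge> 0\<close> of \<open>(1 + c g\<^sub>k) ^ (1 / d ^ (k + 1))\<close>, where \<open>g\<^sub>k\<close> is the \<open>k\<close>-th
  iterate of \<open>g\<close>. Since \<open>p\<close> divides \<open>d\<close>, the binomial coefficients satisfy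
  \<open>\<bar>1 / d ^ (k + 1) gchoose n\<bar> = \<bar>d\<bar> ^ (- (k + 1) n) / \<bar>n!\<bar>\<close>, so the \<open>k\<close>-th factor has radius of
  convergence \<open>1 / r\<^sub>k\<close>, where \<open>r\<^sub>k\<close> is given by the formula for \<open>r\<^sub>N\<close> with \<open>k\<close> in place of \<open>N\<close>. Each of Conditions A and B ensures that \<open>r\<^sub>k\<close> has its strict maximum at
  \<open>k = N\<close>. Hence the \<open>N\<close>-th factor alone determines the radius of \<open>B\<close>. On that radius \<open>1 / r\<^sub>N\<close> all
  nonconstant terms of \<open>B\<close> have size at most \<open>p\<close> to the power \<open>- 1 / (p - 1)\<close>, which is less than 1:
  this makes \<open>\<phi>\<close> an isometry, passes to the inverse series, and shows that convergence beyond
  \<open>1 / r\<^sub>N\<close> would force all terms to have size at most 1 on a slightly larger disk, which the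
  \<open>N\<close>-th factor forbids.
\<close>

section \<open>Non-archimedean and p-adic absolute values\<close>

locale nonarch_absval =
  fixes nv :: "'a::field_char_0 \<Rightarrow> real"
  assumes nv_0 [simp]: "nv 0 = 0"
    and nv_pos: "x \<noteq> 0 \<Longrightarrow> nv x > 0"
    and nv_mult: "nv (x * y) = nv x * nv y"
    and nv_add: "nv (x + y) \<le> max (nv x) (nv y)"
begin

lemma nv_nonneg [simp]: "nv x \<ge> 0"
  using nv_pos[of x] by (cases "x = 0") auto

lemma nv_eq_0_iff [simp]: "nv x = 0 \<longleftrightarrow> x = 0"
  using nv_pos[of x] by fastforce

lemma nv_1 [simp]: "nv 1 = 1"
  using nv_mult[of 1 1] nv_pos[of 1] by simp

lemma nv_minus [simp]: "nv (- x) = nv x"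
proof -
  have "nv (-1) ^ 2 = 1"
    using nv_mult[of "-1" "-1"] by (simp add: power2_eq_square)
  then have "nv (-1) = 1"
    by (simp add: power2_eq_1_iff) (smt (verit) nv_nonneg)
  then show ?thesis
    using nv_mult[of "-1" x] by simp
qed

lemma nv_diff: "nv (x - y) \<le> max (nv x) (nv y)"
  using nv_add[of x "- y"] by simp

lemma nv_minus_commute: "nv (x - y) = nv (y - x)"
  using nv_minus[of "x - y"] by simp

lemma nv_power: "nv (x ^ n) = nv x ^ n"
  by (induction n) (simp_all add: nv_mult)

lemma nv_divide: "nv (x / y) = nv x / nv y"
  using nv_mult[of "x / y" y] by (cases "y = 0") (auto simp: field_simps)

lemma nv_prod: "nv (prod f A) = (\<Prod>i\<in>A. nv (f i))"
  by (induction A rule: infinite_finite_induct) (simp_all add: nv_mult)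

lemma nv_sum_le:
  assumes "e \<ge> 0" "\<And>i. i \<in> A \<Longrightarrow> nv (f i) \<le> e"
  shows "nv (sum f A) \<le> e"
  using assms(2)
proof (induction A rule: infinite_finite_induct)
  case (insert a A)
  then show ?case
    using nv_add[of "f a" "sum f A"] by force
qed (use \<open>e \<ge> 0\<close> in auto)

text \<open>The isosceles triangle principle: of the three sides \<open>x - y\<close>,
  \<open>x\<close>, \<open>y\<close> the two largest have equal length.\<close>

lemma nv_eq_of_diff_less:
  assumes "nv (x - y) < nv y"
  shows "nv x = nv y"
proof -
  have "nv x \<le> max (nv (x - y)) (nv y)" "nv y \<le> max (nv x) (nv (x - y))"
    using nv_add[of "x - y" y] nv_diff[of x "x - y"] by auto
  with assms show ?thesis by auto
qed

lemma nv_of_nat_le_1 [simp]: "nv (of_nat n) \<le> 1"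
proof (induction n)
  case (Suc n)
  then show ?case using nv_add[of 1 "of_nat n"] by simp
qed simp

lemma nv_of_int_le_1 [simp]: "nv (of_int n) \<le> 1"
  using nv_of_nat_le_1[of "nat n"] nv_of_nat_le_1[of "nat (- n)"]
  by (cases "n \<ge> 0") auto

end

section \<open>Absolute values of integers, factorials and binomial coefficients\<close>

locale padic_absval = nonarch_absval nv for nv :: "'a::field_char_0 \<Rightarrow> real" +
  fixes p :: nat
  assumes prime_p: "prime p"
    and nv_p: "nv (of_nat p) = 1 / real p"
begin

lemma p_ge_2: "p \<ge> 2"
  using prime_p by (rule prime_ge_2_nat)

lemma nv_of_nat_dvd:
  assumes "p dvd n"
  shows "nv (of_nat n) < 1"
proof -
  obtain k where "n = p * k" using assms by blast
  then have "nv (of_nat n) \<le> 1 / real p * 1"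
    by (simp only: of_nat_mult nv_mult nv_p) (intro mult_left_mono; simp)
  also have "\<dots> < 1" using p_ge_2 by simp
  finally show ?thesis .
qed

text \<open>In a Bezout relation between \<open>p\<close> and \<open>n\<close> the multiple of
  \<open>p\<close> is smaller than 1, so the multiple of \<open>n\<close> must carry the value
  1.\<close>

lemma nv_of_nat_coprime:
  assumes "\<not> p dvd n"
  shows "nv (of_nat n) = 1"
proof -
  have "coprime (int p) (int n)"
    using assms prime_p prime_imp_coprime_nat coprime_int_iff by blast
  then obtain a b where ab: "a * int p + b * int n = 1"
    by (metis bezout_int coprime_iff_gcd_eq_1)
  have "1 = of_int a * of_nat p + of_int b * (of_nat n :: 'a)"
    using arg_cong[OF ab, of "of_int :: int \<Rightarrow> 'a"] by simp
  then have "1 \<le> max (nv (of_int a * of_nat p)) (nv (of_int b * of_nat n))"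
    using nv_add[of "of_int a * of_nat p" "of_int b * of_nat n"] by simp
  moreover have "nv (of_int a * of_nat p) < 1"
    using nv_of_nat_dvd[of p] mult_right_mono[OF nv_of_int_le_1[of a], of "nv (of_nat p)"]
    by (simp add: nv_mult)
  moreover have "nv (of_int b * of_nat n) \<le> nv (of_nat n)"
    using mult_right_mono[OF nv_of_int_le_1[of b], of "nv (of_nat n)"]
    by (simp add: nv_mult)
  ultimately show ?thesis
    using nv_of_nat_le_1[of n] by linarith
qed

lemma nv_of_nat:
  assumes "n > 0"
  shows "nv (of_nat n) = (1 / real p) ^ multiplicity p n"
proof -
  obtain m where m: "n = p ^ multiplicity p n * m" "\<not> p dvd m"
    using assms prime_p multiplicity_decompose'[of n p]
    by (metis bot_nat_0.not_eq_extremum not_prime_unit)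
  have "nv (of_nat n) = nv (of_nat (p ^ multiplicity p n * m))"
    using m(1) by simp
  also have "\<dots> = (1 / real p) ^ multiplicity p n"
    using nv_of_nat_coprime[OF m(2)] by (simp only: of_nat_mult of_nat_power nv_mult nv_power nv_p mult_1_right)
  finally show ?thesis .
qed

text \<open>This is the radius of convergence of the p-adic exponential. Its power
  \<open>p - 1\<close> is \<open>1 / p\<close>, which makes it the natural unit for the sizes of
  factorials.\<close>

definition \<theta> :: real where "\<theta> = (1 / real p) powr (1 / (real p - 1))"

lemma \<theta>_pos: "0 < \<theta>"
  using p_ge_2 by (simp add: \<theta>_def)

lemma \<theta>_less_1: "\<theta> < 1"
  using p_ge_2 powr_less_mono2[of "1 / (real p - 1)" "1 / real p" 1] by (simp add: \<theta>_def)

lemma ln_\<theta>: "ln \<theta> = - ln (real p) / (real p - 1)"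
  using p_ge_2 by (simp add: \<theta>_def ln_powr ln_div)

lemma \<theta>_power: "\<theta> ^ (p - 1) = 1 / real p"
proof -
  have "\<theta> ^ (p - 1) = \<theta> powr real (p - 1)"
    using \<theta>_pos by (simp add: powr_realpow)
  also have "\<dots> = 1 / real p"
    using p_ge_2 by (simp add: \<theta>_def powr_powr of_nat_diff)
  finally show ?thesis .
qed

text \<open>Legendre's formula in recursive form: only the \<open>n div p\<close> multiples of
  \<open>p\<close> in the factorial contribute, and taking \<open>p\<close> out of each leaves the
  factorial of \<open>n div p\<close>.\<close>

lemma nv_fact_div: "nv (fact n) = \<theta> ^ ((p - 1) * (n div p)) * nv (fact (n div p))"
proof (induction n)
  case (Suc n)
  have *: "nv (fact (Suc n)) = nv (of_nat (Suc n)) * nv (fact n)" for n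
    by (subst fact_Suc) (rule nv_mult)
  show ?case
  proof (cases "p dvd Suc n")
    case True
    then have q: "Suc n div p = Suc (n div p)"
      by (simp add: div_Suc mod_eq_0_iff_dvd)
    then have q': "Suc n = p * Suc (n div p)"
      using True by (metis dvd_mult_div_cancel)
    have "nv (of_nat (Suc n)) = \<theta> ^ (p - 1) * nv (of_nat (Suc (n div p)))"
      by (subst q') (simp only: of_nat_mult nv_mult nv_p \<theta>_power)
    then show ?thesis
      using Suc by (simp only: q * power_add mult_Suc_right) simp
  next
    case False
    then have "Suc n div p = n div p"
      by (simp add: div_Suc mod_eq_0_iff_dvd)
    then show ?thesis
      using Suc nv_of_nat_coprime[OF False] by (simp only: *)
  qed
qed simp

text \<open>The exponent of \<open>\<theta>\<close> in \<open>n!\<close> is \<open>n\<close> minus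
  the base-\<open>p\<close> digit sum, hence at most \<open>n - 1\<close>; the induction removes one
  digit at a time through \<open>n div p\<close>.\<close>

lemma nv_fact_ge: "n > 0 \<Longrightarrow> \<theta> ^ (n - 1) \<le> nv (fact n)"
proof (induction n rule: less_induct)
  case (less n)
  define q where "q = n div p"
  have n: "nv (fact n) = \<theta> ^ ((p - 1) * q) * nv (fact q)"
    unfolding q_def by (rule nv_fact_div)
  show ?case
  proof (cases "q = 0")
    case True
    then show ?thesis using n \<theta>_pos \<theta>_less_1 by (simp add: power_le_one)
  next
    case False
    have "q < n" "p * q \<le> n"
      using less.prems p_ge_2 by (auto simp: q_def)
    have "(p - 1) * q + (q - 1) = p * q - 1"
      using False p_ge_2 by (cases p; cases q) auto
    then have "\<theta> ^ (n - 1) \<le> \<theta> ^ ((p - 1) * q + (q - 1))"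
      using \<open>p * q \<le> n\<close> \<theta>_pos \<theta>_less_1 by (intro power_decreasing) auto
    also have "\<dots> \<le> nv (fact n)"
      using less.IH[of q] \<open>q < n\<close> False \<theta>_pos
      by (simp only: n power_add mult_left_mono zero_le_power less_imp_le neq0_conv)
    finally show ?thesis .
  qed
qed

text \<open>At powers of \<open>p\<close> the digit sum is 1, so the general lower bound is
  attained. These indices later force divergence.\<close>

lemma nv_fact_prime_power: "nv (fact (p ^ j)) = \<theta> ^ (p ^ j - 1)"
proof (induction j)
  case (Suc j)
  have "(p - 1) * p ^ j + (p ^ j - 1) = p ^ Suc j - 1"
    using p_ge_2 by (cases p; cases "p ^ j") auto
  moreover have "p ^ Suc j div p = p ^ j"
    using p_ge_2 by simp
  ultimately show ?case
    using nv_fact_div[of "p ^ Suc j"] Suc.IH by (simp flip: power_add)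
qed simp

text \<open>Each factor of the numerator is \<open>(1 - i m) / m\<close>, and \<open>1 - i m\<close>
  is a p-adic unit because \<open>p\<close> divides \<open>m\<close>.\<close>

lemma nv_gbinomial:
  assumes "p dvd m" "m > 0"
  shows "nv ((1 / of_nat m) gchoose n) = 1 / (nv (of_nat m) ^ n * nv (fact n))"
proof -
  have "nv (1 / of_nat m - of_nat i) = 1 / nv (of_nat m)" for i
  proof -
    have "nv (1 - of_nat (i * m)) = nv 1"
      using nv_of_nat_dvd[of "i * m"] assms by (intro nv_eq_of_diff_less) simp
    then have "nv (1 - of_nat i * of_nat m) = 1"
      by simp
    moreover have "1 / of_nat m - of_nat i = (1 - of_nat i * of_nat m) / (of_nat m :: 'a)"
      using assms by (simp add: field_simps)
    ultimately show ?thesis by (simp add: nv_divide)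
  qed
  then show ?thesis
    by (simp add: gbinomial_prod_rev nv_divide nv_prod power_one_over)
qed

end

section \<open>Power series with bounded coefficients\<close>

text \<open>The cofactor of \<open>f - g\<close> in \<open>f ^ m - g ^ m\<close> has constant term
  \<open>m\<close>, which is nonzero in characteristic 0, so it is a unit.\<close>

lemma fps_dvd_diff_of_power:
  fixes f g :: "'a::field_char_0 fps"
  assumes "fps_nth f 0 = 1" "fps_nth g 0 = 1" "m > 0" and dvd: "fps_X ^ n dvd f ^ m - g ^ m"
  shows "fps_X ^ n dvd f - g"
proof -
  define s where "s = (\<Sum>i<m. g ^ (m - Suc i) * f ^ i)"
  have "fps_nth s 0 = of_nat m"
    using assms by (simp add: s_def fps_sum_nth fps_power_zeroth)
  then have "is_unit s"
    using \<open>m > 0\<close> by simp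
  moreover have "f ^ m - g ^ m = (f - g) * s"
    by (simp add: s_def power_diff_sumr2)
  ultimately show ?thesis
    using dvd by (simp add: dvd_mult_unit_iff)
qed

lemma fps_X_power_dvd_nth:
  fixes f g :: "'a::field fps"
  assumes "fps_X ^ n dvd f - g" "i < n"
  shows "fps_nth f i = fps_nth g i"
proof -
  obtain h where "f - g = fps_X ^ n * h" using assms(1) by blast
  then have "fps_nth (f - g) i = 0"
    using assms(2) by (simp only: fps_X_power_mult_nth if_True)
  then show ?thesis by simp
qed

lemma fps_X_power_dvd_compose_minus_1:
  fixes f h :: "'a::field fps"
  assumes "fps_nth f 0 = 1" "fps_nth h 0 = 0" "fps_X ^ n dvd h"
  shows "fps_X ^ n dvd (f oo h) - 1"
proof -
  have "f - 1 = fps_X * fps_shift 1 (f - 1)"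
    using assms(1) by (intro fps_ext) simp
  then have "(f oo h) - 1 = (fps_X * fps_shift 1 (f - 1)) oo h"
    by (metis fps_compose_1 fps_compose_sub_distrib)
  also have "\<dots> = h * (fps_shift 1 (f - 1) oo h)"
    using assms(2) by (simp add: fps_compose_mult_distrib)
  finally show ?thesis
    using assms(3) by simp
qed

context nonarch_absval
begin

lemma nv_sum_weight_le:
  assumes "0 \<le> e" "0 \<le> r" "\<And>i. i \<in> A \<Longrightarrow> nv (f i) * r \<le> e"
  shows "nv (sum f A) * r \<le> e"
proof (cases "r = 0")
  case False
  then have "nv (sum f A) \<le> e / r"
    using assms by (intro nv_sum_le) (auto simp: field_simps)
  then show ?thesis using False assms by (simp add: field_simps)
qed (use assms in simp)

text \<open>The bound \<open>n\<close> on the index lets coefficient recursions be treated by induction and lets \<open>f\<close> be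
  replaced by an approximation. A threshold \<open>t < 1\<close> gives uniformly strict inequalities.\<close>

definition unit_le :: "real \<Rightarrow> real \<Rightarrow> nat \<Rightarrow> 'a fps \<Rightarrow> bool" where
  "unit_le t r n f \<longleftrightarrow> fps_nth f 0 = 1 \<and> (\<forall>i\<in>{1..n}. nv (fps_nth f i) * r ^ i \<le> t)"

lemma unit_le_nth_0: "unit_le t r n f \<Longrightarrow> fps_nth f 0 = 1"
  by (simp add: unit_le_def)

lemma unit_le_weaken: "unit_le t r n f \<Longrightarrow> t \<le> t' \<Longrightarrow> n' \<le> n \<Longrightarrow> unit_le t' r n' f"
  by (force simp: unit_le_def)

lemma unit_le_1 [simp]: "0 \<le> t \<Longrightarrow> unit_le t r n 1"
  by (simp add: unit_le_def)

lemma unit_le_weight: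
  assumes "unit_le t r n f" "t \<le> 1" "i \<le> n"
  shows "nv (fps_nth f i) * r ^ i \<le> 1"
  proof (cases "i = 0")
  case False
  then show ?thesis using assms order_trans[of "nv (fps_nth f i) * r ^ i" t 1] by (auto simp: unit_le_def)
qed (use assms in \<open>simp add: unit_le_def\<close>)

lemma unit_le_weight_mult:
  assumes f: "unit_le t r n f" and g: "unit_le t r n g" and t: "0 \<le> t" "t \<le> 1" and r: "0 \<le> r"
    and ij: "i + j \<le> n" "0 < i \<or> 0 < j"
  shows "nv (fps_nth f i * fps_nth g j) * r ^ (i + j) \<le> t"
proof -
  have eq: "nv (fps_nth f i * fps_nth g j) * r ^ (i + j)
      = (nv (fps_nth f i) * r ^ i) * (nv (fps_nth g j) * r ^ j)"
    by (simp add: nv_mult power_add)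
  have 1: "nv (fps_nth f i) * r ^ i \<le> 1" "nv (fps_nth g j) * r ^ j \<le> 1"
    using unit_le_weight f g t ij by auto
  from ij(2) show ?thesis
  proof
    assume "0 < i"
    then have "nv (fps_nth f i) * r ^ i \<le> t" using f ij by (simp add: unit_le_def)
    then show ?thesis
      unfolding eq using mult_mono[OF _ 1(2), of _ t] r t by simp
  next
    assume "0 < j"
    then have "nv (fps_nth g j) * r ^ j \<le> t" using g ij by (simp add: unit_le_def)
    then show ?thesis
      unfolding eq using mult_mono[OF 1(1), of _ t] r t by simp
  qed
qed

lemma unit_le_mult:
  assumes f: "unit_le t r n f" and g: "unit_le t r n g" and t: "0 \<le> t" "t \<le> 1" and r: "0 \<le> r"
  shows "unit_le t r n (f * g)"
  unfolding unit_le_def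
proof (intro conjI ballI)
  show "fps_nth (f * g) 0 = 1" using f g by (simp add: unit_le_def)
  fix i assume i: "i \<in> {1..n}"
  show "nv (fps_nth (f * g) i) * r ^ i \<le> t"
    unfolding fps_mult_nth
  proof (rule nv_sum_weight_le)
    fix j assume "j \<in> {0..i}"
    then show "nv (fps_nth f j * fps_nth g (i - j)) * r ^ i \<le> t"
      using unit_le_weight_mult[OF f g t r, of j "i - j"] i by (cases "j = 0") auto
  qed (use t r in auto)
qed

lemma unit_le_power:
  assumes "unit_le t r n f" "0 \<le> t" "t \<le> 1" "0 \<le> r"
  shows "unit_le t r n (f ^ k)"
  by (induction k) (use assms in \<open>auto intro: unit_le_mult\<close>)

lemma unit_le_prod:
  assumes "\<And>k. k \<in> A \<Longrightarrow> unit_le t r n (f k)" "0 \<le> t" "t \<le> 1" "0 \<le> r"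
  shows "unit_le t r n (prod f A)"
  using assms(1)
  by (induction A rule: infinite_finite_induct) (use assms(2-) in \<open>auto intro: unit_le_mult\<close>)

text \<open>Solving the convolution for the next coefficient of \<open>g\<close> leaves products
  with some \<open>fps_nth f j\<close>, \<open>j \<ge> 1\<close>. That factor already supplies the
  bound \<open>t\<close>, so weight at most 1 is enough for the known coefficients of
  \<open>g\<close>.\<close>

lemma unit_le_cancel:
  assumes f: "unit_le t r n f" and fg: "unit_le t r n (f * g)" and t: "0 \<le> t" "t \<le> 1" and r: "0 \<le> r"
  shows "unit_le t r n g"
proof -
  have g0: "fps_nth g 0 = 1" using f fg by (simp add: unit_le_def)
  have "i \<le> n \<Longrightarrow> unit_le t r i g" for i
  proof (induction i)
    case 0
    then show ?case by (simp add: unit_le_def g0)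
  next
    case (Suc i)
    have IH: "unit_le t r i g" using Suc by simp
    have "fps_nth (f * g) (Suc i) =
        fps_nth g (Suc i) + (\<Sum>j=1..Suc i. fps_nth f j * fps_nth g (Suc i - j))"
      using unit_le_nth_0[OF f] by (simp add: fps_mult_nth sum.atLeast_Suc_atMost)
    then have eq: "fps_nth g (Suc i) =
        fps_nth (f * g) (Suc i) - (\<Sum>j=1..Suc i. fps_nth f j * fps_nth g (Suc i - j))"
      by simp
    have "nv (\<Sum>j=1..Suc i. fps_nth f j * fps_nth g (Suc i - j)) * r ^ Suc i \<le> t"
    proof (rule nv_sum_weight_le)
      fix j assume j: "j \<in> {1..Suc i}"
      have "nv (fps_nth f j) * r ^ j \<le> t"
        using f j Suc.prems by (simp add: unit_le_def)
      moreover have "nv (fps_nth g (Suc i - j)) * r ^ (Suc i - j) \<le> 1"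
        using unit_le_weight[OF IH t(2), of "Suc i - j"] j by auto
      ultimately have "(nv (fps_nth f j) * r ^ j) * (nv (fps_nth g (Suc i - j)) * r ^ (Suc i - j)) \<le> t * 1"
        using r t by (intro mult_mono) auto
      moreover have "r ^ Suc i = r ^ j * r ^ (Suc i - j)"
        using j by (subst power_add[symmetric]) auto
      ultimately show "nv (fps_nth f j * fps_nth g (Suc i - j)) * r ^ Suc i \<le> t"
        by (simp only: nv_mult mult_1_right mult_ac)
    qed (use t r in auto)
    moreover have "nv (fps_nth (f * g) (Suc i)) * r ^ Suc i \<le> t"
      using fg Suc.prems by (simp add: unit_le_def del: power_Suc)
    ultimately have "nv (fps_nth g (Suc i)) * r ^ Suc i \<le> t"
      unfolding eq
      using mult_right_mono[OF nv_diff, of "r ^ Suc i"] r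
      by (smt (verit, best) max_def zero_le_power)
    then show ?case
      using IH by (auto simp: unit_le_def le_Suc_eq simp del: power_Suc)
  qed
  then show ?thesis by blast
qed

lemma fps_X_power_mult_power_nth:
  "fps_nth ((fps_X ^ m * v) ^ j) i = (if i < m * j then 0 else fps_nth (v ^ j) (i - m * j))"
  for v :: "'b::comm_ring_1 fps"
  by (simp add: power_mult_distrib fps_X_power_mult_nth flip: power_mult)

text \<open>Term \<open>j \<ge> 1\<close> of the composition starts at \<open>X ^ (m * j)\<close>,
  so coefficient \<open>i\<close> sees \<open>v\<close> only up to index \<open>i - m\<close>. The
  gain in \<open>n \<le> n' + m\<close> makes the induction for the inverse series work.\<close>

lemma unit_le_compose:
  assumes f0: "fps_nth f 0 = 1" and f: "\<And>j. j \<in> {1..n} \<Longrightarrow> nv (fps_nth f j) * r ^ (m * j) \<le> t"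
    and v: "unit_le 1 r n' v" and n: "n \<le> n' + m" and t: "0 \<le> t" and r: "0 \<le> r"
  shows "unit_le t r n (f oo (fps_X ^ m * v))"
  unfolding unit_le_def
proof (intro conjI ballI)
  show "fps_nth (f oo (fps_X ^ m * v)) 0 = 1" using f0 by simp
  fix i assume i: "i \<in> {1..n}"
  show "nv (fps_nth (f oo (fps_X ^ m * v)) i) * r ^ i \<le> t"
    unfolding fps_compose_nth
  proof (rule nv_sum_weight_le)
    fix j assume j: "j \<in> {0..i}"
    show "nv (fps_nth f j * fps_nth ((fps_X ^ m * v) ^ j) i) * r ^ i \<le> t"
    proof (cases "j = 0 \<or> i < m * j")
      case True
      then show ?thesis using t i by (auto simp: fps_X_power_mult_power_nth)
    next
      case False
      have "m \<le> m * j" using False by (cases j) auto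
      then have "i - m * j \<le> i - m" by (rule diff_le_mono2)
      also have "\<dots> \<le> n'" using n i by auto
      finally have "i - m * j \<le> n'" .
      then have "nv (fps_nth (v ^ j) (i - m * j)) * r ^ (i - m * j) \<le> 1"
        using unit_le_weight[OF unit_le_power[OF v]] r by simp
      then have "(nv (fps_nth f j) * r ^ (m * j)) * (nv (fps_nth (v ^ j) (i - m * j)) * r ^ (i - m * j)) \<le> t * 1"
        using f[of j] i j False r t by (intro mult_mono) auto
      moreover have "r ^ i = r ^ (m * j) * r ^ (i - m * j)"
        using False by (subst power_add[symmetric]) auto
      moreover have "fps_nth ((fps_X ^ m * v) ^ j) i = fps_nth (v ^ j) (i - m * j)"
        using False by (simp add: fps_X_power_mult_power_nth)
      ultimately show ?thesis
        by (simp only: nv_mult mult_1_right mult_ac)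
    qed
  qed (use t r in auto)
qed

text \<open>The coefficient of \<open>X ^ (m * j)\<close> in the composition is \<open>f\<^sub>j\<close> plus a combination of
  lower coefficients of \<open>f\<close>.\<close>

lemma nth_le_of_unit_le_compose:
  assumes fv: "\<And>n. unit_le 1 r n (f oo (fps_X ^ m * v))" and v: "\<And>n. unit_le 1 r n v"
    and m: "m > 0" and r: "0 \<le> r"
  shows "nv (fps_nth f j) * r ^ (m * j) \<le> 1"
proof (induction j rule: less_induct)
  case (less j)
  define a where "a = (\<lambda>i. fps_nth f i * fps_nth (v ^ i) (m * j - m * i))"
  have "fps_nth (f oo (fps_X ^ m * v)) (m * j) =
      (\<Sum>i=0..m*j. if i \<in> {..j} then a i else 0)"
    using m by (auto simp: fps_compose_nth fps_X_power_mult_power_nth a_def intro!: sum.cong)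
  also have "\<dots> = (\<Sum>i\<in>{0..m*j} \<inter> {..j}. a i)"
    by (rule sum.inter_restrict[symmetric]) simp
  also have "{0..m*j} \<inter> {..j} = insert j {..<j}"
    using m by auto
  also have "(\<Sum>i\<in>\<dots>. a i) = fps_nth f j + (\<Sum>i<j. a i)"
    using unit_le_nth_0[OF unit_le_power[OF v]] r by (simp add: a_def)
  finally have eq: "fps_nth f j = fps_nth (f oo (fps_X ^ m * v)) (m * j) - (\<Sum>i<j. a i)"
    by simp
  have "nv (\<Sum>i<j. a i) * r ^ (m * j) \<le> 1"
  proof (rule nv_sum_weight_le)
    fix i assume i: "i \<in> {..<j}"
    have "nv (fps_nth (v ^ i) (m * j - m * i)) * r ^ (m * j - m * i) \<le> 1"
      using unit_le_weight[OF unit_le_power[OF v] _ order_refl] r by simp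
    then have "(nv (fps_nth f i) * r ^ (m * i)) * (nv (fps_nth (v ^ i) (m * j - m * i)) * r ^ (m * j - m * i)) \<le> 1 * 1"
      using less[of i] i r by (intro mult_mono) auto
    moreover have "r ^ (m * j) = r ^ (m * i) * r ^ (m * j - m * i)"
      using i by (subst power_add[symmetric]) auto
    ultimately show "nv (a i) * r ^ (m * j) \<le> 1"
      by (simp only: nv_mult mult_1_right mult_ac a_def)
  qed (use r in auto)
  moreover have "nv (fps_nth (f oo (fps_X ^ m * v)) (m * j)) * r ^ (m * j) \<le> 1"
    using unit_le_weight[OF fv _ order_refl] by simp
  ultimately show ?case
    unfolding eq
    using mult_right_mono[OF nv_diff, of "r ^ (m * j)"] r
    by (smt (verit, best) max_def zero_le_power)
qed

text \<open>Finitely many terms have slack because \<open>t < 1\<close>, and continuity in the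
  radius keeps them below 1; the remaining terms decay geometrically because they are bounded at the
  larger radius \<open>s\<close>.\<close>

lemma eventually_unit_le_1:
  assumes f: "\<And>n. unit_le t r n f" and t: "0 \<le> t" "t < 1" and r: "0 < r" "r < s"
    and C: "\<And>n. nv (fps_nth f n) * s ^ n \<le> C"
  shows "\<forall>\<^sub>F r' in at_right r. \<forall>n. unit_le 1 r' n f"
proof -
  define u where "u = (r + s) / 2"
  have u: "r < u" "u < s" using r by (auto simp: u_def)
  have C0: "C \<ge> 0" using order_trans[OF nv_nonneg] C[of 0] by simp
  have "(\<lambda>n. C * (u / s) ^ n) \<longlonglongrightarrow> C * 0"
    using u r by (intro tendsto_intros LIMSEQ_realpow_zero) auto
  then have "\<forall>\<^sub>F n in sequentially. C * (u / s) ^ n < 1"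
    by (intro order_tendstoD(2)[where y = 0]) auto
  then obtain n0 where n0: "\<And>n. n \<ge> n0 \<Longrightarrow> C * (u / s) ^ n < 1"
    by (auto simp: eventually_sequentially)
  have "((\<lambda>r'. (r' / r) ^ n0 * t) \<longlongrightarrow> (r / r) ^ n0 * t) (at_right r)"
    using r by (intro tendsto_intros) auto
  then have "\<forall>\<^sub>F r' in at_right r. (r' / r) ^ n0 * t < 1"
    using r t by (intro order_tendstoD(2)) auto
  moreover have "\<forall>\<^sub>F r' in at_right r. r < r' \<and> r' < u"
    using eventually_at_right_real[OF u(1)] by (simp add: eventually_mono)
  ultimately show ?thesis
  proof eventually_elim
    case (elim r')
    have "nv (fps_nth f n) * r' ^ n \<le> 1" if "n > 0" for n
    proof (cases "n \<le> n0")
      case True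
      have "nv (fps_nth f n) * r' ^ n = (r' / r) ^ n * (nv (fps_nth f n) * r ^ n)"
        using r by (simp add: power_divide)
      also have "\<dots> \<le> (r' / r) ^ n0 * t"
        using f[of n] that elim r True t
        by (intro mult_mono power_increasing) (auto simp: unit_le_def)
      finally show ?thesis using elim by simp
    next
      case False
      have "nv (fps_nth f n) * r' ^ n = (nv (fps_nth f n) * s ^ n) * (r' / s) ^ n"
        using r by (simp add: power_divide)
      also have "\<dots> \<le> C * (u / s) ^ n"
        using C[of n] elim r C0 u by (intro mult_mono power_mono divide_right_mono) auto
      finally show ?thesis using n0[of n] False by simp
    qed
    then show ?case
      using unit_le_nth_0[OF f] by (auto simp: unit_le_def)
  qed
qed

text \<open>The inverse \<open>\<psi> = X G\<close> satisfies \<open>(B oo \<psi>) * G = 1\<close>.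
  Up to index \<open>n + 1\<close> the first factor depends on \<open>G\<close> only up to
  \<open>n\<close>, so it is bounded by induction, and cancellation extends the bound on
  \<open>G\<close>.\<close>

lemma unit_le_fps_inv:
  assumes B: "\<And>n. unit_le t r n B" and t: "0 \<le> t" "t \<le> 1" and r: "0 \<le> r"
  obtains G where "fps_inv (fps_X * B) = fps_X * G" "\<And>n. unit_le t r n G"
proof -
  define \<psi> where "\<psi> = fps_inv (fps_X * B)"
  define G where "G = fps_shift 1 \<psi>"
  have \<psi>0: "fps_nth \<psi> 0 = 0"
    by (simp add: \<psi>_def fps_inv_def)
  have \<psi>: "\<psi> = fps_X * G"
    using \<psi>0 by (intro fps_ext) (simp add: G_def)
  have B0: "fps_nth B 0 = 1" using unit_le_nth_0[OF B] .
  have "fps_X = (fps_X * B) oo \<psi>"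
    using B0 by (simp add: \<psi>_def fps_inv_right)
  also have "\<dots> = fps_X * (G * (B oo \<psi>))"
    using \<psi>0 by (simp add: fps_compose_mult_distrib \<psi> mult.assoc)
  finally have eq: "(B oo \<psi>) * G = 1"
    by (metis fps_X_neq_zero mult.commute mult_cancel_left mult.right_neutral)
  have G0: "fps_nth G 0 = 1"
    using arg_cong[OF eq, of "\<lambda>f. fps_nth f 0"] B0 by simp
  have "unit_le t r n G" for n
  proof (induction n)
    case 0
    then show ?case using G0 by (simp add: unit_le_def)
  next
    case (Suc n)
    have "unit_le t r (Suc n) (B oo (fps_X ^ 1 * G))"
    proof (rule unit_le_compose)
      show "unit_le 1 r n G" using Suc unit_le_weaken t by blast
      show "nv (fps_nth B j) * r ^ (1 * j) \<le> t" if "j \<in> {1..Suc n}" for j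
        using B[of "Suc n"] that by (simp add: unit_le_def)
    qed (use t r B0 in auto)
    then have "unit_le t r (Suc n) (B oo \<psi>)"
      by (simp add: \<psi>)
    moreover have "unit_le t r (Suc n) ((B oo \<psi>) * G)"
      using eq t by simp
    ultimately show ?case
      using unit_le_cancel t r by blast
  qed
  then show thesis
    using that[of G] \<psi> unfolding \<psi>_def by blast
qed

end

section \<open>Radius of convergence and evaluation\<close>

lemma LIMSEQ_0_of_le:
  fixes f g :: "nat \<Rightarrow> real"
  assumes "\<And>n. 0 \<le> f n" "\<And>n. f n \<le> g n" "g \<longlonglongrightarrow> 0"
  shows "f \<longlonglongrightarrow> 0"
  by (rule tendsto_sandwich[of "\<lambda>_. 0" f sequentially g]) (use assms in auto)

lemma LIMSEQ_0_of_le_geometric: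
  fixes f :: "nat \<Rightarrow> real"
  assumes "\<And>n. 0 \<le> f n" "\<And>n. f n \<le> C * q ^ n" "0 \<le> q" "q < 1"
  shows "f \<longlonglongrightarrow> 0"
proof (rule LIMSEQ_0_of_le[OF assms(1,2)])
  have "(\<lambda>n. C * q ^ n) \<longlonglongrightarrow> C * 0"
    using assms by (intro tendsto_intros LIMSEQ_realpow_zero) auto
  then show "(\<lambda>n. C * q ^ n) \<longlonglongrightarrow> 0" by simp
qed

lemma (in nonarch_absval) nv_conv_radius_eqI:
  assumes B: "\<And>n. unit_le 1 R n B" and R: "R > 0"
    and unbounded: "\<And>s C. R < s \<Longrightarrow> \<exists>n. nv (fps_nth B n) * s ^ n > C"
  shows "nv_conv_radius nv (fps_nth (fps_X * B)) = ereal R"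
  unfolding nv_conv_radius_def
proof (rule antisym)
  show "(SUP r\<in>{r. 0 \<le> r \<and> (\<lambda>n. nv (fps_nth (fps_X * B) n) * r ^ n) \<longlonglongrightarrow> 0}. ereal r) \<le> ereal R"
  proof (rule SUP_least, rule ccontr)
    fix r assume r: "r \<in> {r. 0 \<le> r \<and> (\<lambda>n. nv (fps_nth (fps_X * B) n) * r ^ n) \<longlonglongrightarrow> 0}"
      and "\<not> ereal r \<le> ereal R"
    then have "r > R" by simp
    have "Bseq (\<lambda>n. nv (fps_nth (fps_X * B) n) * r ^ n)"
      using r by (auto intro!: convergent_imp_Bseq convergentI)
    then obtain C where C: "\<And>n. nv (fps_nth (fps_X * B) n) * r ^ n \<le> C"
      unfolding Bseq_def by (metis abs_le_D1 real_norm_def)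
    obtain n where "nv (fps_nth B n) * r ^ n > C / r"
      using unbounded[OF \<open>r > R\<close>] by blast
    then have "nv (fps_nth B n) * r ^ Suc n > C"
      using \<open>r > R\<close> R by (simp add: field_simps)
    then show False
      using C[of "Suc n"] by simp
  qed
next
  show "ereal R \<le> (SUP r\<in>{r. 0 \<le> r \<and> (\<lambda>n. nv (fps_nth (fps_X * B) n) * r ^ n) \<longlonglongrightarrow> 0}. ereal r)"
  proof (rule dense_le)
    fix y :: ereal assume y: "y < ereal R"
    define r where "r = max 0 (real_of_ereal y)"
    have r: "0 \<le> r" "r < R" "y \<le> ereal r"
      using y R by (cases y; auto simp: r_def)+
    have "(\<lambda>n. nv (fps_nth (fps_X * B) n) * r ^ n) \<longlonglongrightarrow> 0"
    proof (rule LIMSEQ_imp_Suc, rule LIMSEQ_0_of_le_geometric)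
      fix n
      have "nv (fps_nth (fps_X * B) (Suc n)) * r ^ Suc n = r * (nv (fps_nth B n) * R ^ n) * (r / R) ^ n"
        using R by (simp add: power_divide)
      also have "\<dots> \<le> r * 1 * (r / R) ^ n"
        using unit_le_weight[OF B _ order_refl] r R by (intro mult_right_mono mult_left_mono) auto
      finally show "nv (fps_nth (fps_X * B) (Suc n)) * r ^ Suc n \<le> r * (r / R) ^ n" by simp
      show "0 \<le> nv (fps_nth (fps_X * B) (Suc n)) * r ^ Suc n"
        using r by (intro mult_nonneg_nonneg nv_nonneg zero_le_power)
    qed (use r R in auto)
    then show "y \<le> (SUP r\<in>{r. 0 \<le> r \<and> (\<lambda>n. nv (fps_nth (fps_X * B) n) * r ^ n) \<longlonglongrightarrow> 0}. ereal r)"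
      using r by (intro SUP_upper2[of r]) auto
  qed
qed

section \<open>Limits with respect to the absolute value\<close>

context nonarch_absval
begin

lemma nv_limit_unique:
  assumes "(\<lambda>n. nv (s n - l)) \<longlonglongrightarrow> 0" "(\<lambda>n. nv (s n - l')) \<longlonglongrightarrow> 0"
  shows "l = l'"
proof -
  have "(\<lambda>n. max (nv (s n - l)) (nv (s n - l'))) \<longlonglongrightarrow> max 0 0"
    using assms by (intro tendsto_max)
  moreover have "nv (l - l') \<le> max (nv (s n - l)) (nv (s n - l'))" for n
    using nv_diff[of "s n - l'" "s n - l"] by (simp add: max.commute)
  ultimately have "nv (l - l') \<le> 0"
    by (intro LIMSEQ_le_const) auto
  then show ?thesis
    using nv_pos[of "l - l'"] by force
qed

text \<open>Near a limit of size greater than \<open>e\<close> the absolute value is constant, so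
  eventually \<open>nv (s n) = nv l\<close>, against the bound.\<close>

lemma nv_limit_le:
  assumes lim: "(\<lambda>n. nv (s n - l)) \<longlonglongrightarrow> 0" and le: "\<forall>\<^sub>F n in sequentially. nv (s n) \<le> e"
    and "e \<ge> 0"
  shows "nv l \<le> e"
proof (rule ccontr)
  assume "\<not> nv l \<le> e"
  then have "\<forall>\<^sub>F n in sequentially. nv (s n - l) < nv l"
    using \<open>e \<ge> 0\<close> by (intro order_tendstoD(2)[OF lim]) auto
  then have "\<forall>\<^sub>F n in sequentially. False"
    using le
  proof eventually_elim
    case (elim n)
    then show ?case using nv_eq_of_diff_less[of "s n" l] \<open>\<not> nv l \<le> e\<close> by simp
  qed
  then show False by simp
qed

text \<open>The cofactor of \<open>x - y\<close> is a sum of monomials of size at most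
  \<open>r ^ n\<close>; the ultrametric inequality costs no factor \<open>n + 1\<close>.\<close>

lemma nv_diff_power_le:
  assumes "nv x \<le> r" "nv y \<le> r"
  shows "nv (x ^ Suc n - y ^ Suc n) \<le> nv (x - y) * r ^ n"
proof -
  have "r \<ge> 0" using assms(1) nv_nonneg order_trans by blast
  have "nv (\<Sum>i<Suc n. y ^ (Suc n - Suc i) * x ^ i) \<le> r ^ n"
  proof (rule nv_sum_le)
    fix i assume "i \<in> {..<Suc n}"
    then have "r ^ n = r ^ (Suc n - Suc i) * r ^ i"
      by (subst power_add[symmetric]) auto
    then show "nv (y ^ (Suc n - Suc i) * x ^ i) \<le> r ^ n"
      using assms \<open>r \<ge> 0\<close> by (simp only: nv_mult nv_power) (intro mult_mono power_mono; simp)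
  qed (use \<open>r \<ge> 0\<close> in simp)
  then show ?thesis
    by (simp only: power_diff_sumr2 nv_mult mult_left_mono nv_nonneg)
qed

end

section \<open>Evaluation of a series as a bijective isometry of an open disk\<close>

locale complete_nonarch_absval = nonarch_absval +
  assumes complete: "(\<And>e. e > 0 \<Longrightarrow> \<exists>M. \<forall>m\<ge>M. \<forall>n\<ge>M. nv (s m - s n) < e)
    \<Longrightarrow> \<exists>l. (\<lambda>n. nv (s n - l)) \<longlonglongrightarrow> 0"
begin

text \<open>The ultrametric inequality bounds every difference by the largest step in between, so
  steps tending to 0 already give a Cauchy sequence.\<close>

lemma ex_limit:
  assumes "(\<lambda>n. nv (s (Suc n) - s n)) \<longlonglongrightarrow> 0"
  shows "\<exists>l. (\<lambda>n. nv (s n - l)) \<longlonglongrightarrow> 0"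
proof (rule complete)
  fix e :: real assume e: "e > 0"
  then obtain M where M: "\<And>n. n \<ge> M \<Longrightarrow> nv (s (Suc n) - s n) < e"
    using order_tendstoD(2)[OF assms] by (auto simp: eventually_sequentially)
  have *: "nv (s m - s M) < e" if "m \<ge> M" for m
    using that
  proof (induction m rule: dec_induct)
    case (step m)
    then show ?case
      using nv_add[of "s (Suc m) - s m" "s m - s M"] M[of m] by simp
  qed (use e in simp)
  have "nv (s m - s n) < e" if "m \<ge> M" "n \<ge> M" for m n
    using nv_diff[of "s m - s M" "s n - s M"] *[OF that(1)] *[OF that(2)] by simp
  then show "\<exists>M. \<forall>m\<ge>M. \<forall>n\<ge>M. nv (s m - s n) < e" by blast
qed

context
  fixes B :: "'a fps" and R :: real
  assumes R: "R > 0" and B: "\<And>n. unit_le 1 R n B"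
begin

lemma nth_weight_le:
  assumes "0 \<le> r"
  shows "nv (fps_nth (fps_X * B) (Suc n)) * r ^ n \<le> (r / R) ^ n"
proof -
  have "nv (fps_nth (fps_X * B) (Suc n)) * r ^ n = (nv (fps_nth B n) * R ^ n) * (r / R) ^ n"
    using R by (simp add: power_divide)
  also have "\<dots> \<le> 1 * (r / R) ^ n"
    using unit_le_weight[OF B _ order_refl] assms R by (intro mult_right_mono) auto
  finally show ?thesis by simp
qed

lemma nv_eval_limit:
  assumes x: "nv x < R"
  shows "(\<lambda>n. nv ((\<Sum>i<n. fps_nth (fps_X * B) i * x ^ i) - nv_eval nv (fps_X * B) x)) \<longlonglongrightarrow> 0"
proof -
  have "(\<lambda>n. nv (fps_nth (fps_X * B) n * x ^ n)) \<longlonglongrightarrow> 0"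
  proof (rule LIMSEQ_imp_Suc, rule LIMSEQ_0_of_le_geometric)
    fix n
    show "nv (fps_nth (fps_X * B) (Suc n) * x ^ Suc n) \<le> nv x * (nv x / R) ^ n"
      using mult_left_mono[OF nth_weight_le[OF nv_nonneg, of n x], of "nv x"]
      by (simp add: nv_mult nv_power mult_ac)
  qed (use x R in auto)
  then have "\<exists>l. (\<lambda>n. nv ((\<Sum>i<n. fps_nth (fps_X * B) i * x ^ i) - l)) \<longlonglongrightarrow> 0"
    by (intro ex_limit) (simp del: fps_X_mult_nth)
  then have "\<exists>!l. (\<lambda>n. nv ((\<Sum>i<n. fps_nth (fps_X * B) i * x ^ i) - l)) \<longlonglongrightarrow> 0"
    by (auto intro: nv_limit_unique)
  then show ?thesis
    unfolding nv_eval_def by (rule theI')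
qed

text \<open>The linear terms cancel, and term \<open>i \<ge> 2\<close> gains a factor
  \<open>(r / R) ^ (i - 1)\<close>. Evaluation is thus the identity plus a strict
  contraction.\<close>

lemma nv_eval_diff_le:
  assumes x: "nv x \<le> r" and y: "nv y \<le> r" and r: "r < R"
  shows "nv (nv_eval nv (fps_X * B) x - nv_eval nv (fps_X * B) y - (x - y)) \<le> r / R * nv (x - y)"
proof (rule nv_limit_le)
  define S where "S = (\<lambda>x n. \<Sum>i<n. fps_nth (fps_X * B) i * x ^ i)"
  have r0: "r \<ge> 0" using x nv_nonneg order_trans by blast
  have "(\<lambda>n. max (nv (S x n - nv_eval nv (fps_X * B) x)) (nv (S y n - nv_eval nv (fps_X * B) y)))
      \<longlonglongrightarrow> max 0 0"
    unfolding S_def using x y r by (intro tendsto_max nv_eval_limit) auto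
  then have lim: "(\<lambda>n. max (nv (S x n - nv_eval nv (fps_X * B) x)) (nv (S y n - nv_eval nv (fps_X * B) y)))
      \<longlonglongrightarrow> 0" by simp
  show "(\<lambda>n. nv (S x n - S y n - (x - y)
      - (nv_eval nv (fps_X * B) x - nv_eval nv (fps_X * B) y - (x - y)))) \<longlonglongrightarrow> 0"
  proof (rule LIMSEQ_0_of_le)
    fix n
    have "S x n - S y n - (x - y) - (nv_eval nv (fps_X * B) x - nv_eval nv (fps_X * B) y - (x - y))
      = (S x n - nv_eval nv (fps_X * B) x) - (S y n - nv_eval nv (fps_X * B) y)"
      by simp
    then show "nv (S x n - S y n - (x - y)
        - (nv_eval nv (fps_X * B) x - nv_eval nv (fps_X * B) y - (x - y)))
      \<le> max (nv (S x n - nv_eval nv (fps_X * B) x)) (nv (S y n - nv_eval nv (fps_X * B) y))"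
      by (simp only: nv_diff)
  qed (use lim in simp_all)
  have "nv (S x n - S y n - (x - y)) \<le> r / R * nv (x - y)" if n: "n \<ge> 2" for n
  proof -
    have "fps_nth B 0 = 1" using unit_le_nth_0[OF B] .
    define a where "a = (\<lambda>i. fps_nth (fps_X * B) i * (x ^ i - y ^ i))"
    have "S x n - S y n = (\<Sum>i<n. a i)"
      by (simp add: S_def a_def right_diff_distrib sum_subtractf)
    \<comment> \<open>Index 0 contributes nothing, and index 1 contributes \<open>x - y\<close> as
      \<open>B\<close> has constant term 1.\<close>
    also have "{..<n} = insert 0 (insert 1 {2..<n})"
      using n by auto
    also have "(\<Sum>i\<in>\<dots>. a i) = (x - y) + (\<Sum>i=2..<n. a i)"
      using \<open>fps_nth B 0 = 1\<close> by (simp add: a_def)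
    finally have "S x n - S y n - (x - y) = (\<Sum>i=2..<n. a i)" by simp
    moreover have "nv (\<Sum>i=2..<n. a i) \<le> r / R * nv (x - y)"
    proof (rule nv_sum_le)
      fix i assume "i \<in> {2..<n}"
      then have "i = Suc (Suc (i - 2))" by auto
      then obtain j where i: "i = Suc (Suc j)" by blast
      have "nv (a i) \<le> nv (fps_nth (fps_X * B) i) * (nv (x - y) * r ^ Suc j)"
        unfolding a_def nv_mult i by (intro mult_left_mono nv_diff_power_le x y nv_nonneg)
      also have "\<dots> \<le> (r / R) ^ Suc j * nv (x - y)"
        using mult_right_mono[OF nth_weight_le[OF r0, of "Suc j"] nv_nonneg[of "x - y"]]
        by (simp only: i mult_ac)
      also have "\<dots> \<le> (r / R) ^ 1 * nv (x - y)"
        using r r0 R by (intro mult_right_mono power_decreasing) auto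
      finally show "nv (a i) \<le> r / R * nv (x - y)" by simp
    qed (use r0 R in auto)
    ultimately show ?thesis by simp
  qed
  then show "\<forall>\<^sub>F n in sequentially. nv (S x n - S y n - (x - y)) \<le> r / R * nv (x - y)"
    by (auto simp: eventually_sequentially)
  show "0 \<le> r / R * nv (x - y)" using r0 R by simp
qed

lemma nv_eval_isometry:
  assumes "nv x < R" "nv y < R"
  shows "nv (nv_eval nv (fps_X * B) x - nv_eval nv (fps_X * B) y) = nv (x - y)"
proof (cases "x = y")
  case False
  have "nv (nv_eval nv (fps_X * B) x - nv_eval nv (fps_X * B) y - (x - y))
      \<le> max (nv x) (nv y) / R * nv (x - y)"
    using assms by (intro nv_eval_diff_le) auto
  also have "\<dots> < 1 * nv (x - y)"
    using assms R False nv_pos[of "x - y"] by (intro mult_strict_right_mono) auto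
  finally show ?thesis
    by (intro nv_eq_of_diff_less) simp
qed simp

lemma nv_eval_0: "nv_eval nv (fps_X * B) 0 = 0"
proof -
  have "(\<Sum>i<n. fps_nth (fps_X * B) i * 0 ^ i) = 0" for n
    by (intro sum.neutral) (simp add: power_0_left)
  then show ?thesis
    using nv_eval_limit[of 0] R by (simp add: LIMSEQ_const_iff)
qed

lemma nv_nv_eval: "nv x < R \<Longrightarrow> nv (nv_eval nv (fps_X * B) x) = nv x"
  using nv_eval_isometry[of x 0] R by (simp add: nv_eval_0)

text \<open>Banach iteration for the map \<open>x + (y - F x)\<close>, which contracts the closed
  disk of radius \<open>nv y\<close> by the ratio \<open>nv y / R < 1\<close> and whose fixed points
  solve \<open>F x = y\<close>.\<close>

lemma nv_eval_surj:
  assumes y: "nv y < R"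
  shows "\<exists>x. nv x < R \<and> nv_eval nv (fps_X * B) x = y"
proof -
  define F where "F = nv_eval nv (fps_X * B)"
  define s where "s = rec_nat 0 (\<lambda>n x. x + (y - F x))"
  have s: "s 0 = 0" "s (Suc n) = s n + (y - F (s n))" for n
    by (simp_all add: s_def)
  have le: "nv (s n) \<le> nv y" for n
  proof (induction n)
    case (Suc n)
    have "nv (F (s n)) \<le> nv y" using Suc y nv_nv_eval by (simp add: F_def)
    then show ?case
      using Suc nv_add[of "s n" "y - F (s n)"] nv_diff[of y "F (s n)"] by (simp add: s)
  qed (simp add: s)
  have step: "nv (s (Suc n) - s n) \<le> (nv y / R) ^ n * nv y" for n
  proof (induction n)
    case 0
    then show ?case by (simp add: s F_def nv_eval_0)
  next
    case (Suc n)
    have "s (Suc (Suc n)) - s (Suc n) = - (F (s (Suc n)) - F (s n) - (s (Suc n) - s n))"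
      using s(2)[of n] s(2)[of "Suc n"] by (simp add: algebra_simps)
    then have "nv (s (Suc (Suc n)) - s (Suc n)) \<le> nv y / R * nv (s (Suc n) - s n)"
      using nv_eval_diff_le[OF le le y, of "Suc n" n] by (simp only: F_def nv_minus)
    also have "\<dots> \<le> nv y / R * ((nv y / R) ^ n * nv y)"
      using Suc R by (intro mult_left_mono) auto
    finally show ?case by (simp add: mult_ac)
  qed
  have lim0: "(\<lambda>n. nv (s (Suc n) - s n)) \<longlonglongrightarrow> 0"
    by (rule LIMSEQ_0_of_le_geometric[where C = "nv y" and q = "nv y / R"])
      (use step y R in \<open>auto simp: mult.commute\<close>)
  then obtain x where x: "(\<lambda>n. nv (s n - x)) \<longlonglongrightarrow> 0"
    using ex_limit by blast
  have "nv x \<le> nv y"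
    using nv_limit_le[OF x] le by simp
  then have xR: "nv x < R" using y by simp
  have "nv (F (s n) - F x) = nv (s n - x)" for n
    using nv_eval_isometry[of "s n" x] le[of n] y xR by (simp add: F_def)
  then have "(\<lambda>n. nv (F (s n) - F x)) \<longlonglongrightarrow> 0"
    using x by simp
  moreover have "(\<lambda>n. nv (F (s n) - y)) \<longlonglongrightarrow> 0"
    using lim0 by (simp add: s nv_minus_commute)
  ultimately have "F x = y"
    by (rule nv_limit_unique)
  then show ?thesis using xR by (auto simp: F_def)
qed

lemma bij_betw_nv_eval: "bij_betw (nv_eval nv (fps_X * B)) {x. nv x < R} {x. nv x < R}"
  unfolding bij_betw_def
proof
  show "inj_on (nv_eval nv (fps_X * B)) {x. nv x < R}"
  proof (rule inj_onI)
    fix x y assume "x \<in> {x. nv x < R}" "y \<in> {x. nv x < R}"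
      and "nv_eval nv (fps_X * B) x = nv_eval nv (fps_X * B) y"
    then show "x = y" using nv_eval_isometry[of x y] by simp
  qed
  show "nv_eval nv (fps_X * B) ` {x. nv x < R} = {x. nv x < R}"
  proof
    show "nv_eval nv (fps_X * B) ` {x. nv x < R} \<subseteq> {x. nv x < R}"
      using nv_nv_eval by auto
    show "{x. nv x < R} \<subseteq> nv_eval nv (fps_X * B) ` {x. nv x < R}"
      using nv_eval_surj by force
  qed
qed

end

end

section \<open>The functional equation\<close>

text \<open>Only what Conditions A and B have in common is assumed here; their inequalities enter
  later through the exponents \<open>L k\<close>.\<close>

locale boettcher_absval = padic_absval nv p for nv :: "'a::field_char_0 \<Rightarrow> real" and p +
  fixes d :: nat and c :: 'a
  assumes d_ge_2: "d \<ge> 2" and p_dvd_d: "p dvd d" and c_nonzero: "c \<noteq> 0"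
begin

text \<open>\<open>iterate k\<close> is the \<open>k\<close>-th iterate of \<open>g = X ^ d + c X ^ (d + 1)\<close>.\<close>

primrec iterate_unit :: "nat \<Rightarrow> 'a fps" where
  "iterate_unit 0 = 1"
| "iterate_unit (Suc k) =
    iterate_unit k ^ d * (1 + fps_const c * (fps_X ^ d ^ k * iterate_unit k))"

definition iterate :: "nat \<Rightarrow> 'a fps" where
  "iterate k = fps_X ^ d ^ k * iterate_unit k"

lemma iterate_0: "iterate 0 = fps_X"
  by (simp add: iterate_def)

lemma iterate_Suc: "iterate (Suc k) = iterate k ^ d * (1 + fps_const c * iterate k)"
  by (simp add: iterate_def power_mult_distrib mult_ac flip: power_mult)

lemma iterate_nth_0 [simp]: "fps_nth (iterate k) 0 = 0"
  using d_ge_2 by (simp add: iterate_def fps_power_zeroth)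

lemma compose_iterate: "(fps_X ^ d + fps_const c * fps_X ^ (d + 1)) oo iterate k = iterate (Suc k)"
  by (simp add: fps_compose_add_distrib fps_compose_mult_distrib iterate_Suc
      algebra_simps flip: fps_compose_power)

text \<open>As \<open>r \<le> 1\<close>, the weight of \<open>c X ^ (d ^ k)\<close> is at most that
  of \<open>c X\<close>, which is at most 1; products then preserve the bound along the
  recursion.\<close>

lemma unit_le_iterate_unit:
  assumes r: "0 \<le> r" "r \<le> 1" "nv c * r \<le> 1"
  shows "unit_le 1 r n (iterate_unit k)"
proof (induction k)
  case (Suc k)
  have "unit_le 1 r n (1 + fps_const c * (fps_X ^ d ^ k * iterate_unit k))"
    unfolding unit_le_def
  proof (intro conjI ballI)
    show "fps_nth (1 + fps_const c * (fps_X ^ d ^ k * iterate_unit k)) 0 = 1"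
      using d_ge_2 by (simp add: fps_power_zeroth)
    fix i assume i: "i \<in> {1..n}"
    show "nv (fps_nth (1 + fps_const c * (fps_X ^ d ^ k * iterate_unit k)) i) * r ^ i \<le> 1"
    proof (cases "i < d ^ k")
      case True
      then show ?thesis using i by (simp add: fps_X_power_mult_nth)
    next
      case False
      have "r ^ d ^ k \<le> r ^ 1"
        using r d_ge_2 by (intro power_decreasing) auto
      then have "nv c * r ^ d ^ k \<le> 1"
        using mult_left_mono[of "r ^ d ^ k" r "nv c"] r by simp
      moreover have "nv (fps_nth (iterate_unit k) (i - d ^ k)) * r ^ (i - d ^ k) \<le> 1"
        using unit_le_weight[OF Suc, of "i - d ^ k"] i by auto
      ultimately have "(nv c * r ^ d ^ k) * (nv (fps_nth (iterate_unit k) (i - d ^ k)) * r ^ (i - d ^ k)) \<le> 1 * 1"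
        using r by (intro mult_mono) auto
      moreover have "r ^ i = r ^ d ^ k * r ^ (i - d ^ k)"
        using False by (subst power_add[symmetric]) auto
      moreover have "fps_nth (1 + fps_const c * (fps_X ^ d ^ k * iterate_unit k)) i
          = c * fps_nth (iterate_unit k) (i - d ^ k)"
        using False i by (simp add: fps_X_power_mult_nth)
      ultimately show ?thesis
        by (simp only: nv_mult mult_1_right mult_ac)
    qed
  qed
  then show ?case
    using Suc r by (simp add: unit_le_mult unit_le_power)
qed simp

definition binom :: "nat \<Rightarrow> 'a fps" where
  "binom k = fps_binomial (1 / of_nat (d ^ Suc k)) oo (fps_const c * fps_X)"

text \<open>\<open>root_factor k\<close> is \<open>(1 + c g\<^sub>k) ^ (1 / d ^ (k + 1))\<close>, and \<open>weight k r / \<theta>\<close> is the number whose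
  powers control its coefficients on the disk of radius \<open>r\<close>.\<close>

definition root_factor :: "nat \<Rightarrow> 'a fps" where
  "root_factor k = binom k oo iterate k"

definition weight :: "nat \<Rightarrow> real \<Rightarrow> real" where
  "weight k r = nv c / nv (of_nat d) ^ Suc k * r ^ d ^ k"

lemma binom_nth: "fps_nth (binom k) n = c ^ n * ((1 / of_nat (d ^ Suc k)) gchoose n)"
  unfolding binom_def fps_compose_linear by simp

lemma binom_nth_0: "fps_nth (binom k) 0 = 1"
  by (simp add: binom_nth)

lemma nv_binom_nth: "nv (fps_nth (binom k) n) * r ^ (d ^ k * n) = weight k r ^ n / nv (fact n)"
proof -
  have "nv ((1 / of_nat (d ^ Suc k)) gchoose n) = 1 / ((nv (of_nat d) ^ Suc k) ^ n * nv (fact n))"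
    using nv_gbinomial[of "d ^ Suc k" n] p_dvd_d d_ge_2
    by (simp only: of_nat_power nv_power) (simp add: dvd_mult2 power_mult_distrib)
  then show ?thesis
    unfolding binom_nth nv_mult weight_def
    by (simp add: nv_power power_mult_distrib power_divide power_mult del: power_Suc)
qed

lemma root_factor_power: "root_factor k ^ (d ^ Suc k) = 1 + fps_const c * iterate k"
proof -
  have "root_factor k ^ (d ^ Suc k) =
      ((fps_binomial (1 / of_nat (d ^ Suc k)) ^ (d ^ Suc k)) oo (fps_const c * fps_X)) oo iterate k"
    by (simp add: root_factor_def binom_def fps_compose_power del: power_Suc)
  also have "fps_binomial (1 / of_nat (d ^ Suc k)) ^ (d ^ Suc k) = (1 + fps_X :: 'a fps)"
    using d_ge_2 by (simp add: fps_binomial_power fps_binomial_1 del: power_Suc)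
  also have "((1 + fps_X) oo (fps_const c * fps_X)) oo iterate k = 1 + fps_const c * iterate k"
    by (simp add: fps_compose_add_distrib fps_compose_mult_distrib)
  finally show ?thesis .
qed

lemma root_factor_nth_0: "fps_nth (root_factor k) 0 = 1"
  by (simp add: root_factor_def binom_nth_0)

text \<open>Since \<open>j!\<close> has size at least \<open>\<theta> ^ (j - 1)\<close>, dividing
  \<open>\<theta> ^ j\<close> by it leaves at most \<open>\<theta>\<close>.\<close>

lemma unit_le_root_factor:
  assumes r: "0 \<le> r" "r \<le> 1" "nv c * r \<le> 1" and w: "weight k r \<le> \<theta>"
  shows "unit_le \<theta> r n (root_factor k)"
  unfolding root_factor_def iterate_def
proof (rule unit_le_compose)
  fix j assume j: "j \<in> {1..n}"
  have "weight k r ^ j \<le> \<theta> ^ j"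
    using w r by (intro power_mono) (auto simp: weight_def)
  also have "\<dots> = \<theta> * \<theta> ^ (j - 1)"
    using j by (cases j) auto
  also have "\<dots> \<le> \<theta> * nv (fact j)"
    using nv_fact_ge[of j] j \<theta>_pos by (intro mult_left_mono) auto
  finally show "nv (fps_nth (binom k) j) * r ^ (d ^ k * j) \<le> \<theta>"
    unfolding nv_binom_nth using nv_pos[of "fact j"] by (simp add: field_simps)
next
  show "unit_le 1 r n (iterate_unit k)"
    using r by (rule unit_le_iterate_unit)
qed (use r \<theta>_pos binom_nth_0 in auto)

section \<open>The product formula for the unit part \<open>B\<close> of the coordinate\<close>

context
  fixes B :: "'a fps"
  assumes B0: "fps_nth B 0 = 1"
    and B_eq: "B ^ d = (1 + fps_const c * fps_X) * (B oo (fps_X ^ d + fps_const c * fps_X ^ (d + 1)))"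
begin

lemma B_iterate: "(B oo iterate k) ^ d = (1 + fps_const c * iterate k) * (B oo iterate (Suc k))"
proof -
  have g0: "fps_nth (fps_X ^ d + fps_const c * fps_X ^ (d + 1)) 0 = (0 :: 'a)"
    using d_ge_2 by (simp add: fps_power_zeroth)
  have "(B oo iterate k) ^ d = B ^ d oo iterate k"
    by (simp add: fps_compose_power)
  also have "\<dots> = (1 + fps_const c * iterate k)
      * (B oo (fps_X ^ d + fps_const c * fps_X ^ (d + 1)) oo iterate k)"
    unfolding B_eq by (simp add: fps_compose_mult_distrib fps_compose_add_distrib)
  also have "B oo (fps_X ^ d + fps_const c * fps_X ^ (d + 1)) oo iterate k = B oo iterate (Suc k)"
    using fps_compose_assoc[OF iterate_nth_0 g0, of B k] by (simp only: compose_iterate)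
  finally show ?thesis .
qed

text \<open>Iterating the functional equation peels off one factor at a time. In
  \<open>d ^ K\<close>-th powers the product formula is an exact finite identity with remainder
  \<open>B oo iterate K\<close>.\<close>

lemma B_power: "B ^ d ^ K = (\<Prod>k<K. root_factor k) ^ d ^ K * (B oo iterate K)"
proof (induction K)
  case 0
  then show ?case by (simp add: iterate_0)
next
  case (Suc K)
  have "B ^ d ^ Suc K = (B ^ d ^ K) ^ d"
    by (simp add: mult.commute flip: power_mult)
  also have "\<dots> = (\<Prod>k<K. root_factor k) ^ d ^ Suc K * (B oo iterate K) ^ d"
    unfolding Suc by (simp add: power_mult_distrib mult.commute flip: power_mult)
  also have "\<dots> = ((\<Prod>k<K. root_factor k) * root_factor K) ^ d ^ Suc K * (B oo iterate (Suc K))"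
    by (simp only: B_iterate power_mult_distrib root_factor_power mult.assoc)
  finally show ?case by simp
qed

text \<open>The remainder \<open>B oo iterate K\<close> is 1 modulo \<open>X ^ (d ^ K)\<close>, and
  \<open>fps_dvd_diff_of_power\<close> removes the power \<open>d ^ K\<close>.\<close>

lemma B_nth:
  assumes "n < d ^ K"
  shows "fps_nth B n = fps_nth (\<Prod>k<K. root_factor k) n"
proof (rule fps_X_power_dvd_nth[OF fps_dvd_diff_of_power assms])
  show "fps_nth (\<Prod>k<K. root_factor k) 0 = 1"
    by (induction K) (simp_all add: root_factor_nth_0)
  have "fps_X ^ d ^ K dvd (B oo iterate K) - 1"
    by (rule fps_X_power_dvd_compose_minus_1) (use d_ge_2 in \<open>simp_all add: B0 iterate_def fps_power_zeroth\<close>)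
  moreover have "B ^ d ^ K - (\<Prod>k<K. root_factor k) ^ d ^ K
      = (\<Prod>k<K. root_factor k) ^ d ^ K * ((B oo iterate K) - 1)"
    by (simp add: B_power[of K] algebra_simps)
  ultimately show "fps_X ^ d ^ K dvd B ^ d ^ K - (\<Prod>k<K. root_factor k) ^ d ^ K"
    by simp
qed (use B0 d_ge_2 in auto)

lemma less_d_power: "n < d ^ n"
  using d_ge_2 by (intro power_gt_expt) auto

lemma unit_le_B:
  assumes r: "0 \<le> r" "r \<le> 1" "nv c * r \<le> 1" and w: "\<And>k. weight k r \<le> \<theta>"
  shows "unit_le \<theta> r n B"
proof -
  have "unit_le \<theta> r n (\<Prod>k<n. root_factor k)"
    using r w \<theta>_pos \<theta>_less_1 by (intro unit_le_prod unit_le_root_factor) auto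
  moreover have "fps_nth B i = fps_nth (\<Prod>k<n. root_factor k) i" if "i \<le> n" for i
    using less_d_power[of n] that by (intro B_nth) auto
  ultimately show ?thesis
    by (simp add: unit_le_def)
qed

text \<open>Dividing \<open>B\<close> by the other factors leaves the \<open>N\<close>-th one
  bounded by 1; undoing the substitution bounds \<open>binom N\<close>, whose terms at the indices
  \<open>p ^ j\<close> would be unbounded if \<open>weight N r > \<theta>\<close>.\<close>

lemma weight_le_of_unit_le_B:
  assumes r: "0 \<le> r" "r \<le> 1" "nv c * r \<le> 1" and w: "\<And>k. k \<noteq> N \<Longrightarrow> weight k r \<le> \<theta>"
    and B: "\<And>n. unit_le 1 r n B"
  shows "weight N r \<le> \<theta>"
proof (rule ccontr)
  assume "\<not> weight N r \<le> \<theta>"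
  then have q: "weight N r / \<theta> > 1" using \<theta>_pos by simp
  have "unit_le 1 r n (root_factor N)" for n
  proof (rule unit_le_cancel)
    \<comment> \<open>Large enough for the partial product to contain the factor \<open>N\<close>
      and to agree with \<open>B\<close> up to index \<open>n\<close>.\<close>
    define K where "K = max n (Suc N)"
    have "unit_le \<theta> r n (\<Prod>k\<in>{..<K} - {N}. root_factor k)"
      using r w \<theta>_pos \<theta>_less_1 by (intro unit_le_prod unit_le_root_factor) auto
    then show "unit_le 1 r n (\<Prod>k\<in>{..<K} - {N}. root_factor k)"
      using \<theta>_less_1 by (auto intro: unit_le_weaken)
    have "fps_nth B i = fps_nth (\<Prod>k<K. root_factor k) i" if "i \<le> n" for i
      using less_d_power[of K] that by (intro B_nth) (auto simp: K_def)
    then have "unit_le 1 r n (\<Prod>k<K. root_factor k)"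
      using B[of n] by (simp add: unit_le_def)
    also have "(\<Prod>k<K. root_factor k) = (\<Prod>k\<in>{..<K} - {N}. root_factor k) * root_factor N"
      by (subst prod.remove[of _ N]) (auto simp: K_def mult.commute)
    finally show "unit_le 1 r n ((\<Prod>k\<in>{..<K} - {N}. root_factor k) * root_factor N)" .
  qed (use r in auto)
  then have le: "nv (fps_nth (binom N) j) * r ^ (d ^ N * j) \<le> 1" for j
    unfolding root_factor_def iterate_def
    using unit_le_iterate_unit[OF r] d_ge_2 r by (intro nth_le_of_unit_le_compose) auto
  \<comment> \<open>At index \<open>p ^ j\<close> the factorial has its smallest possible size
    \<open>\<theta> ^ (p ^ j - 1)\<close>; a ratio above 1 would make these powers
    unbounded.\<close>
  have "(weight N r / \<theta>) ^ p ^ j \<le> 1 / \<theta>" for j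
  proof -
    have "weight N r ^ p ^ j \<le> nv (fact (p ^ j))"
      using le[of "p ^ j"] nv_pos[of "fact (p ^ j)"] unfolding nv_binom_nth by (simp add: field_simps)
    also have "\<dots> = \<theta> ^ p ^ j / \<theta>"
      using \<theta>_pos p_ge_2 by (simp add: nv_fact_prime_power power_diff)
    finally show ?thesis
      using \<theta>_pos by (simp add: power_divide field_simps)
  qed
  moreover obtain j where "(weight N r / \<theta>) ^ j > 1 / \<theta>"
    using real_arch_pow[OF q] by blast
  moreover have "(weight N r / \<theta>) ^ j \<le> (weight N r / \<theta>) ^ p ^ j"
    using q p_ge_2 power_gt_expt[of p j] by (intro power_increasing) auto
  ultimately show False
    by (meson leD order_trans)
qed

end

end

section \<open>The radius of convergence of the coordinate\<close>

text \<open>The sign of \<open>L k - L (Suc k)\<close> is that of an expression increasing in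
  \<open>k\<close>. It is positive at \<open>N\<close> by \<open>up\<close> and, unless
  \<open>N = 0\<close>, negative at \<open>N - 1\<close> by \<open>dn\<close>, so \<open>L\<close>
  rises up to \<open>N\<close> and falls afterwards. The bound \<open>l\<close> is uniform over the
  infinitely many \<open>k\<close>, which leaves room for a slightly larger radius.\<close>

lemma ex_strict_max_exponent:
  fixes a \<delta> :: real and d N :: nat
  defines "L \<equiv> \<lambda>k. (a + real (Suc k) * \<delta>) / real d ^ k"
  assumes d: "d \<ge> 2" and \<delta>: "\<delta> > 0"
    and up: "(real d - 1) * (a + real (Suc N) * \<delta>) > \<delta>"
    and dn: "N = 0 \<or> (real d - 1) * (a + real N * \<delta>) < \<delta>"
  shows "L N > 0" and "\<exists>l<L N. \<forall>k. k \<noteq> N \<longrightarrow> L k \<le> l"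
proof -
  have "(real d - 1) * (a + real (Suc N) * \<delta>) > 0"
    using up \<delta> by linarith
  then have "a + real (Suc N) * \<delta> > 0"
    using d by (simp add: zero_less_mult_iff)
  then show "L N > 0"
    using d by (simp add: L_def)
  have diff: "L k - L (Suc k) = ((real d - 1) * (a + real (Suc k) * \<delta>) - \<delta>) / real d ^ Suc k" for k
    using d by (simp add: L_def field_simps)
  have mono: "(real d - 1) * (a + real k * \<delta>) \<le> (real d - 1) * (a + real k' * \<delta>)" if "k \<le> k'" for k k'
    using d \<delta> that by (intro mult_left_mono add_left_mono mult_right_mono) auto
  have dec: "L (Suc k) < L k" if "k \<ge> N" for k
  proof -
    have "\<delta> < (real d - 1) * (a + real (Suc k) * \<delta>)"
      by (rule less_le_trans[OF up mono]) (use that in simp)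
    then have "L k - L (Suc k) > 0"
      unfolding diff using d by (intro divide_pos_pos) auto
    then show ?thesis by simp
  qed
  have inc: "L k < L (Suc k)" if "k < N" for k
  proof -
    have "(real d - 1) * (a + real (Suc k) * \<delta>) \<le> (real d - 1) * (a + real N * \<delta>)"
      using that by (intro mono) simp
    also have "\<dots> < \<delta>" using dn that by simp
    finally have "L k - L (Suc k) < 0"
      unfolding diff using d by (intro divide_neg_pos) auto
    then show ?thesis by simp
  qed
  have above: "L k \<le> L (Suc N)" if "k > N" for k
    using Suc_leI[OF that]
  proof (induction k rule: dec_induct)
    case (step k)
    then show ?case using dec[of k] by simp
  qed simp
  have below: "L k \<le> L (N - 1)" if "k < N" for k
  proof -
    have "k \<le> N - 1" using that by simp
    then show ?thesis
    proof (induction k rule: inc_induct)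
      case (step k)
      then have "k < N" by simp
      then show ?case using inc[of k] step.IH by simp
    qed simp
  qed
  show "\<exists>l<L N. \<forall>k. k \<noteq> N \<longrightarrow> L k \<le> l"
  proof (cases "N = 0")
    case True
    then show ?thesis
      using dec[of N] above by (intro exI[of _ "L (Suc N)"]) auto
  next
    case False
    have "L k \<le> max (L (N - 1)) (L (Suc N))" if "k \<noteq> N" for k
      using above[of k] below[of k] that by (cases "k < N") auto
    moreover have "max (L (N - 1)) (L (Suc N)) < L N"
      using dec[of N] inc[of "N - 1"] False by simp
    ultimately show ?thesis by blast
  qed
qed

context padic_absval
begin

text \<open>The left side is the valuation of \<open>d!\<close>, so the bound is the logarithm of
  \<open>nv_fact_ge\<close>, with equality by \<open>nv_fact_prime_power\<close>.\<close>

lemma multiplicity_fact_pred_le: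
  assumes "d \<ge> 2"
  shows "real (multiplicity p d) + real (multiplicity p (fact (d - 1) :: nat)) \<le> (real d - 1) / (real p - 1)"
    and "d = p ^ k \<Longrightarrow>
      real (multiplicity p d) + real (multiplicity p (fact (d - 1) :: nat)) = (real d - 1) / (real p - 1)"
proof -
  let ?D = "multiplicity p d" and ?V = "multiplicity p (fact (d - 1) :: nat)"
  have "fact d = d * fact (d - 1)"
    using assms by (metis fact_reduce not_numeral_le_zero not_gr0 of_nat_id)
  then have "fact d = (of_nat d * of_nat (fact (d - 1)) :: 'a)"
    by (metis of_nat_fact of_nat_mult)
  then have "nv (fact d) = (1 / real p) ^ ?D * (1 / real p) ^ ?V"
    using assms by (simp only: nv_mult nv_of_nat fact_gt_zero)
  then have ln: "ln (nv (fact d)) = - ((real ?D + real ?V) * ln (real p))"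
    using p_ge_2 by (simp add: ln_realpow ln_div flip: power_add)
  have ln_p: "ln (real p) > 0" using p_ge_2 by simp
  have \<theta>: "ln (\<theta> ^ (d - 1)) = - ((real d - 1) / (real p - 1) * ln (real p))"
    using assms \<theta>_pos by (simp add: ln_realpow ln_\<theta> of_nat_diff)
  have "ln (\<theta> ^ (d - 1)) \<le> ln (nv (fact d))"
    using nv_fact_ge[of d] assms \<theta>_pos by (intro ln_mono) auto
  then show "real ?D + real ?V \<le> (real d - 1) / (real p - 1)"
    unfolding ln \<theta> neg_le_iff_le mult_le_cancel_right_pos[OF ln_p] .
  show "real ?D + real ?V = (real d - 1) / (real p - 1)" if "d = p ^ k"
  proof -
    have "ln (\<theta> ^ (d - 1)) = ln (nv (fact d))"
      using nv_fact_prime_power[of k] that by simp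
    then show ?thesis
      using ln_p unfolding ln \<theta> neg_equal_iff_equal mult_cancel_right by auto
  qed
qed

end

context boettcher_absval
begin

text \<open>\<open>exp (L k)\<close> is the number \<open>r\<^sub>k\<close>.\<close>

definition L :: "nat \<Rightarrow> real" where
  "L k = (ln (nv c) - ln \<theta> + real (Suc k) * (- ln (nv (of_nat d)))) / real d ^ k"

lemma nv_d_pos: "nv (of_nat d) > 0"
  using d_ge_2 by (intro nv_pos) simp

lemma weight_le_iff:
  assumes "r > 0"
  shows "weight k r \<le> \<theta> \<longleftrightarrow> ln r \<le> - L k"
proof -
  have c: "nv c > 0" using c_nonzero by (rule nv_pos)
  have "weight k r \<le> \<theta> \<longleftrightarrow> ln (weight k r) \<le> ln \<theta>"
    using c assms nv_d_pos \<theta>_pos by (simp add: weight_def)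
  also have "ln (weight k r) = ln (nv c) - real (Suc k) * ln (nv (of_nat d)) + real d ^ k * ln r"
    unfolding weight_def using c assms nv_d_pos c_nonzero d_ge_2
    by (simp add: ln_mult ln_div ln_realpow del: power_Suc of_nat_Suc)
  also have "\<dots> \<le> ln \<theta> \<longleftrightarrow> ln r \<le> - L k"
    using d_ge_2 by (auto simp: L_def field_simps)
  finally show ?thesis .
qed

lemma radius_eq:
  "(nv (c / of_nat d ^ (N + 1)) * real p powr (1 / (real p - 1))) powr (1 / real d ^ N) = exp (L N)"
proof -
  have c: "nv c > 0" using c_nonzero by (rule nv_pos)
  define x where "x = nv (c / of_nat d ^ (N + 1)) * real p powr (1 / (real p - 1))"
  have "nv (c / of_nat d ^ (N + 1)) > 0"
    using c_nonzero d_ge_2 by (intro nv_pos) simp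
  then have x: "x > 0" using p_ge_2 by (simp add: x_def)
  have "ln x = ln (nv c) - real (Suc N) * ln (nv (of_nat d)) + ln (real p) / (real p - 1)"
    unfolding x_def using c nv_d_pos p_ge_2 c_nonzero d_ge_2
    by (simp add: nv_divide nv_power ln_mult ln_div ln_realpow ln_powr del: power_Suc of_nat_Suc)
  then have "ln x / real d ^ N = L N"
    by (simp add: L_def ln_\<theta>)
  then have "x powr (1 / real d ^ N) = exp (L N)"
    using x by (simp add: powr_def)
  then show ?thesis by (simp only: x_def)
qed

context
  fixes B :: "'a fps" and N :: nat and l :: real
  assumes B0: "fps_nth B 0 = 1"
    and B_eq: "B ^ d = (1 + fps_const c * fps_X) * (B oo (fps_X ^ d + fps_const c * fps_X ^ (d + 1)))"
    and L_pos: "L N > 0" and l: "l < L N" "\<And>k. k \<noteq> N \<Longrightarrow> L k \<le> l"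
    and c_less: "nv c * exp (- L N) < 1"
begin

lemma unit_le_B_radius: "unit_le \<theta> (exp (- L N)) n B"
proof (rule unit_le_B[OF B0 B_eq])
  show "weight k (exp (- L N)) \<le> \<theta>" for k
    using l by (cases "k = N") (force simp: weight_le_iff)+
qed (use L_pos c_less in auto)

text \<open>Just beyond \<open>exp (- L N)\<close> the radius is still below
  \<open>exp (- l)\<close> and 1 and keeps \<open>nv c * r < 1\<close>, so all other factors stay
  controlled. Boundedness of \<open>B\<close> there would force
  \<open>weight N r \<le> \<theta>\<close>, that is \<open>r \<le> exp (- L N)\<close>.\<close>

lemma not_eventually_unit_le_B: "\<not> (\<forall>\<^sub>F r in at_right (exp (- L N)). \<forall>n. unit_le 1 r n B)"
proof
  assume "\<forall>\<^sub>F r in at_right (exp (- L N)). \<forall>n. unit_le 1 r n B"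
  moreover have "\<forall>\<^sub>F r in at_right (exp (- L N)). r \<in> {exp (- L N) <..< min 1 (exp (- l))}"
    using L_pos l by (intro eventually_at_right_real) auto
  moreover have "\<forall>\<^sub>F r in at_right (exp (- L N)). nv c * r < 1"
    by (rule order_tendstoD(2)[OF _ c_less]) (intro tendsto_intros)
  ultimately have "\<forall>\<^sub>F r in at_right (exp (- L N)). False"
  proof eventually_elim
    case (elim r)
    have r: "r > 0" "r < 1" "exp (- L N) < r" "r < exp (- l)"
      using elim(2) less_trans[OF exp_gt_zero, of "- L N" r] by auto
    have ln_r: "- L N < ln r" "ln r < - l"
      using ln_less_cancel_iff[of "exp (- L N)" r] ln_less_cancel_iff[of r "exp (- l)"] r by simp_all
    have "weight N r \<le> \<theta>"
    proof (rule weight_le_of_unit_le_B[OF B0 B_eq])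
      show "weight k r \<le> \<theta>" if "k \<noteq> N" for k
        using r ln_r l(2)[OF that] by (simp add: weight_le_iff)
    qed (use r elim in auto)
    then show ?case using r ln_r by (simp add: weight_le_iff)
  qed
  then show False by simp
qed

lemma conv_radius:
  "nv_conv_radius nv (fps_nth (fps_X * B)) = ereal (exp (- L N))"
  "nv_conv_radius nv (fps_nth (fps_inv (fps_X * B))) = ereal (exp (- L N))"
proof -
  let ?R = "exp (- L N)"
  \<comment> \<open>Stated for a general \<open>B'\<close> to serve both \<open>B\<close> and the
    unit part \<open>G\<close> of the inverse. If the terms were bounded at some
    \<open>s > ?R\<close>, the slack between \<open>\<theta>\<close> and 1 would give terms of size
    at most 1 just beyond \<open>?R\<close>.\<close>
  have "nv_conv_radius nv (fps_nth (fps_X * B')) = ereal ?R"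
    if B': "\<And>n. unit_le \<theta> ?R n B'" and ne: "\<not> (\<forall>\<^sub>F r in at_right ?R. \<forall>n. unit_le 1 r n B')" for B'
  proof (rule nv_conv_radius_eqI)
    show "unit_le 1 ?R n B'" for n
      using unit_le_weaken[OF B' _ order_refl] \<theta>_less_1 by simp
    show "\<exists>n. nv (fps_nth B' n) * s ^ n > C" if "?R < s" for s C
    proof (rule ccontr)
      assume "\<not> ?thesis"
      then show False
        using eventually_unit_le_1[OF B' _ _ _ \<open>?R < s\<close>] \<theta>_pos \<theta>_less_1 ne
        by (auto simp: not_less)
    qed
  qed simp
  note * = this
  show "nv_conv_radius nv (fps_nth (fps_X * B)) = ereal ?R"
    using unit_le_B_radius not_eventually_unit_le_B by (rule *)
  obtain G where G: "fps_inv (fps_X * B) = fps_X * G" "\<And>n. unit_le \<theta> ?R n G"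
    using unit_le_fps_inv[OF unit_le_B_radius] \<theta>_pos \<theta>_less_1 by (metis exp_ge_zero less_imp_le)
  have inv: "fps_inv (fps_X * G) = fps_X * B"
    using fps_inv_idempotent[of "fps_X * B"] B0 by (simp add: G(1))
  \<comment> \<open>Inverting \<open>X G\<close> gives back \<open>X B\<close>, so a bound on
    \<open>G\<close> beyond \<open>?R\<close> transfers to \<open>B\<close>.\<close>
  have "unit_le 1 r n B" if r: "r > ?R" and G1: "\<And>n. unit_le 1 r n G" for r n
  proof -
    have "r \<ge> 0" using r exp_gt_zero less_imp_le less_trans by metis
    then obtain B' where "fps_inv (fps_X * G) = fps_X * B'" "\<And>n. unit_le 1 r n B'"
      using unit_le_fps_inv[OF G1] by (metis order_refl zero_le_one)
    then show ?thesis using inv by simp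
  qed
  then have B_if_G: "\<forall>n. unit_le 1 r n B" if "?R < r" "\<forall>n. unit_le 1 r n G" for r
    using that by blast
  have "\<not> (\<forall>\<^sub>F r in at_right ?R. \<forall>n. unit_le 1 r n G)"
  proof
    assume "\<forall>\<^sub>F r in at_right ?R. \<forall>n. unit_le 1 r n G"
    with eventually_at_right_less have "\<forall>\<^sub>F r in at_right ?R. \<forall>n. unit_le 1 r n B"
      by eventually_elim (rule B_if_G)
    with not_eventually_unit_le_B show False ..
  qed
  then show "nv_conv_radius nv (fps_nth (fps_inv (fps_X * B))) = ereal ?R"
    unfolding G(1) using G(2) by (intro *) auto
qed

end

end

theorem theorem1p3:
  fixes p N d :: nat and nv :: "'a::field_char_0 \<Rightarrow> real" and c :: 'a and \<phi> :: "'a fps"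
  assumes Cp: "is_Cp_absval p nv"
    and d2: "d \<ge> 2"
    and cond: "condA p nv N d c \<or> condB p nv N d c"
    and phi0: "fps_nth \<phi> 0 = 0" and phi1: "fps_nth \<phi> 1 = 1"
    and boettcher: "\<phi> oo (fps_X ^ d + fps_const c * fps_X ^ (d + 1)) = \<phi> ^ d"
  defines "rN \<equiv> (nv (c / of_nat d ^ (N + 1)) * real p powr (1 / (real p - 1))) powr (1 / real d ^ N)"
  shows "rN > 1
     \<and> nv_conv_radius nv (fps_nth \<phi>) = ereal (1 / rN)
     \<and> nv_conv_radius nv (fps_nth (fps_inv \<phi>)) = ereal (1 / rN)
     \<and> bij_betw (nv_eval nv \<phi>) {x. nv x < 1 / rN} {x. nv x < 1 / rN}
     \<and> (\<forall>x y. nv x < 1 / rN \<longrightarrow> nv y < 1 / rN \<longrightarrow>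
            nv (nv_eval nv \<phi> x - nv_eval nv \<phi> y) = nv (x - y))"
proof -
  have c0: "c \<noteq> 0" using cond by (auto simp: condA_def condB_def)
  have pr: "prime p" using Cp by (simp add: is_Cp_absval_def)
  have pd: "p dvd d"
  proof -
    have "p dvd d" if "d = p ^ k" for k
      using that d2 by (cases k) auto
    then show ?thesis using cond by (auto simp: condA_def condB_def)
  qed
  interpret complete_nonarch_absval nv
    using Cp unfolding is_Cp_absval_def by unfold_locales auto
  interpret boettcher_absval nv p d c
    using Cp d2 pd c0 unfolding is_Cp_absval_def by unfold_locales auto
  define B where "B = fps_shift 1 \<phi>"
  have \<phi>: "\<phi> = fps_X * B"
    using phi0 by (intro fps_ext) (simp add: B_def)
  have B0: "fps_nth B 0 = 1"
    using phi1 by (simp add: B_def)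
  \<comment> \<open>With \<open>\<phi> = X B\<close>, both sides of the functional equation carry a
    factor \<open>X ^ d\<close> that can be cancelled.\<close>
  have "fps_X ^ d * ((1 + fps_const c * fps_X) * (B oo (fps_X ^ d + fps_const c * fps_X ^ (d + 1))))
      = fps_X ^ d * B ^ d"
    using boettcher d2 unfolding \<phi>
    by (simp add: fps_compose_mult_distrib fps_power_zeroth power_mult_distrib algebra_simps)
  then have B_eq: "B ^ d = (1 + fps_const c * fps_X) * (B oo (fps_X ^ d + fps_const c * fps_X ^ (d + 1)))"
    by simp

  \<comment> \<open>The conditions on the valuation of \<open>c\<close> as inequalities for the
    exponents \<open>L k\<close>\<close>
  define v D V where "v = vp p nv c" and "D = real (multiplicity p d)"
    and "V = real (multiplicity p (fact (d - 1) :: nat))"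
  define a \<delta> where "a = ln (nv c) - ln \<theta>" and "\<delta> = - ln (nv (of_nat d))"
  have p1: "ln (real p) > 0" using p_ge_2 by simp
  have ln_c: "ln (nv c) = - v * ln (real p)"
    using p1 by (simp add: v_def vp_def log_def)
  have a: "a = (1 / (real p - 1) - v) * ln (real p)"
    unfolding a_def ln_c ln_\<theta> by (simp add: algebra_simps)
  have \<delta>: "\<delta> = D * ln (real p)"
    using d2 p1 p_ge_2 by (simp add: \<delta>_def D_def nv_of_nat ln_realpow ln_div)
  have "D \<ge> 1"
    using pd d2 pr by (simp add: D_def Suc_le_eq prime_multiplicity_gt_zero_iff)
  then have \<delta>_pos: "\<delta> > 0" using p1 by (simp add: \<delta>)
  \<comment> \<open>For the upper bound on \<open>v\<close>, common to both conditions, an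
    inequality for \<open>V\<close> suffices.\<close>
  have DV: "V \<le> (real d - 1) * (1 / (real p - 1)) - D"
    using multiplicity_fact_pred_le(1)[OF d2] by (simp add: D_def V_def)
  have lt: "v < real (Suc N) * D + V / (real d - 1)"
    using cond by (auto simp: condA_def condB_def v_def D_def V_def add.commute)
  have "(real d - 1) * v < (real d - 1) * (real (Suc N) * D) + V"
    using lt d2 by (simp add: field_simps)
  then have "(real d - 1) * (1 / (real p - 1) - v + real (Suc N) * D) > D"
    using DV by (simp add: algebra_simps)
  then have "(real d - 1) * (1 / (real p - 1) - v + real (Suc N) * D) * ln (real p) > \<delta>"
    unfolding \<delta> using p1 by (intro mult_strict_right_mono)
  then have up: "(real d - 1) * (a + real (Suc N) * \<delta>) > \<delta>"
    by (simp add: a \<delta> algebra_simps)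
  have dn: "(real d - 1) * (a + real N * \<delta>) < \<delta>" if "N \<noteq> 0"
  proof -
    have B: "condB p nv N d c" using cond that by (auto simp: condA_def)
    then obtain k where "d = p ^ k" by (auto simp: condB_def)
    \<comment> \<open>In the lower bound on \<open>v\<close> the quantity \<open>V\<close> stands on
      the other side, so equality is used; it holds because \<open>d\<close> is a power of
      \<open>p\<close>.\<close>
    then have DV: "V = (real d - 1) * (1 / (real p - 1)) - D"
      using multiplicity_fact_pred_le(2)[OF d2, of k] by (simp add: D_def V_def)
    have "v > real N * D + V / (real d - 1)"
      using B by (auto simp: condB_def v_def D_def V_def)
    then have "(real d - 1) * v > (real d - 1) * (real N * D) + V"
      using d2 by (simp add: field_simps)
    then have "(real d - 1) * (1 / (real p - 1) - v + real N * D) < D"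
      using DV by (simp add: algebra_simps)
    then have "(real d - 1) * (1 / (real p - 1) - v + real N * D) * ln (real p) < \<delta>"
      unfolding \<delta> using p1 by (intro mult_strict_right_mono)
    then show ?thesis
      by (simp add: a \<delta> algebra_simps)
  qed
  have L: "L k = (a + real (Suc k) * \<delta>) / real d ^ k" for k
    by (simp add: L_def a_def \<delta>_def)
  have L_pos: "L N > 0"
    unfolding L using ex_strict_max_exponent(1)[OF d2 \<delta>_pos up] dn by blast
  obtain l where l: "l < L N" "\<And>k. k \<noteq> N \<Longrightarrow> L k \<le> l"
    unfolding L using ex_strict_max_exponent(2)[OF d2 \<delta>_pos up] dn by blast
  \<comment> \<open>This says \<open>nv c < rN\<close>, so \<open>c x\<close> has size less than 1
    on the disk. For \<open>N = 0\<close> it is read off the formula; otherwise \<open>dn\<close>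
    forces \<open>a < 0\<close>, hence \<open>nv c < \<theta> < 1 < rN\<close>.\<close>
  have "ln (nv c) < L N"
  proof (cases "N = 0")
    case True
    have "ln \<theta> < 0" using \<theta>_pos \<theta>_less_1 by simp
    then show ?thesis using True \<delta>_pos by (simp add: L a_def)
  next
    case False
    have "1 * \<delta> \<le> (real d - 1) * \<delta>"
      using d2 \<delta>_pos by (intro mult_right_mono) auto
    then have "(real d - 1) * (a + real N * \<delta>) < (real d - 1) * \<delta>"
      using dn[OF False] by linarith
    then have "a + real N * \<delta> < \<delta>"
      using d2 by (subst (asm) mult_less_cancel_left_pos) auto
    moreover have "1 * \<delta> \<le> real N * \<delta>"
      using False \<delta>_pos by (intro mult_right_mono) auto
    ultimately have "a < 0" by simp
    moreover have "ln \<theta> < 0" using \<theta>_pos \<theta>_less_1 by simp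
    ultimately show ?thesis using L_pos by (simp add: a_def)
  qed
  then have "exp (ln (nv c)) < exp (L N)" by simp
  then have c_less: "nv c * exp (- L N) < 1"
    using nv_pos[OF c0] by (simp add: exp_minus field_simps)

  have rN: "rN = exp (L N)"
    unfolding rN_def by (rule radius_eq)
  then have R: "1 / rN = exp (- L N)"
    by (simp add: exp_minus inverse_eq_divide)
  have unit: "unit_le 1 (exp (- L N)) n B" for n
    using unit_le_weaken[OF unit_le_B_radius[OF B0 B_eq L_pos l c_less] _ order_refl] \<theta>_less_1 by simp
  show ?thesis
    unfolding R \<phi>
    using rN L_pos conv_radius[OF B0 B_eq L_pos l c_less]
      bij_betw_nv_eval[OF exp_gt_zero unit] nv_eval_isometry[OF exp_gt_zero unit]
    by auto
qed

end
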